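(* Let $(\mathcal X,d)$ be a bounded complete separable metric space and let $\Xi$ be a weakly time-stationary $L^2$ point process on $\mathcal X\times\mathcal T$. Then there is a constant $\kappa>0$ such that for every finite measurable partition $(A_i)_{i=1}^N$ of $\mathcal X$ and every $t\in\mathcal T_{>0}$ with $t>1$, $$\sum_{i=1}^N\mathrm{Var}\big(\Xi(A_i\times(0,t])\big)\le\kappa t^2\qquad\text{and}\qquad\sum_{i=1}^N\breve\gamma^+_{[2],A_i}([0,t])\le\breve\gamma^+_{[2]}(\mathcal X^2\times[0,t])\le\kappa t.$$
   Context: The time axis is $\mathcal T=\mathbb R$ or $\mathcal T=\mathbb Z$ with reference measure $\ell$ (Lebesgue, resp. counting measure); intervals are intervals in $\mathcal T$, $\mathcal T_{>0}=\{s\in\mathcal T:s>0\}$. A point process on $\mathcal X\times\mathcal T$ is a random counting measure $\Xi=\sum_i\delta_{(X_i,T_i)}$ with finitely many points in $\mathcal X\times I$ for every bounded interval $I$. It is a weakly time-stationary $L^2$ process if its first two moment measures are finite on bounded sets and invariant under time shifts: with $\chi_t(x,s)=(x,s+t)$, $\mathbb E[\Xi(\chi_t^{-1}(A))]=\mathbb E[\Xi(A)]<\infty$ and $\mathbb E[\Xi(\chi_t^{-1}(A))\Xi(\chi_t^{-1}(B))]=\mathbb E[\Xi(A)\Xi(B)]<\infty$ for all bounded Borel $A,B\subseteq\mathcal X\times\mathcal T$, $t\in\mathcal T$. Let $M_1(B)=\mathbb E[\Xi(B)]$ and $M_{[2]}(A\times B\times I\times J)=\mathbb E\sum_{i\ne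 j}1\{X_i\in A,X_j\in B,T_i\in I,T_j\in J\}$. Under weak time-stationarity, $M_1=\mu\otimes\ell$ for a finite measure $\mu$ on $\mathcal X$, and there is a locally finite measure $\breve M_{[2]}$ on $\mathcal X^2\times\mathcal T$ with $M_{[2]}\psi^{-1}(dx\,dy\,dr\,ds)=\ell(dr)\,\breve M_{[2]}(dx\,dy\,ds)$, where $\psi(x,y,r,s)=(x,y,r,s-r)$. The time-reduced factorial covariance measure is the signed measure (on sets with bounded time component) $\breve\gamma_{[2]}(A\times B\times S)=\breve M_{[2]}(A\times B\times S)-\mu(A)\mu(B)\ell(S)$, with $\breve\gamma_{[2],A}(S)=\breve\gamma_{[2]}(A\times A\times S)$. $\breve\gamma^+_{[2]}$ and $\breve\gamma^+_{[2],A}$ are the positive parts in the Jordan decompositions of $\breve\gamma_{[2]}$ and $\breve\gamma_{[2],A}$, respectively. *)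

theory Defs
  imports "HOL-Probability.Probability"
begin

text \<open>
  The time axis is \<open>space ell\<close> for a reference measure \<open>ell :: real measure\<close>, where
  \<open>ell = lborel\<close> (continuous time) or \<open>ell = count_space \<int>\<close> (discrete time, as a
  subset of the reals). Intervals of the time axis are real intervals intersected with
  \<open>space ell\<close>.

  A point process is given by its points: in the state \<open>\<omega>\<close> these are \<open>Z \<omega> i = (X\<^sub>i, T\<^sub>i)\<close>
  for \<open>i \<in> K \<omega>\<close>. Points may coincide, and only the counts, not the enumeration, are required
  to be measurable in \<open>\<omega>\<close>.
\<close>

text \<open>The sum of the Dirac measures at \<open>z i\<close>, \<open>i \<in> I\<close>, on the measurable space \<open>S\<close>.\<close>

definition dirac_sum :: "'a measure \<Rightarrow> 'i set \<Rightarrow> ('i \<Rightarrow> 'a) \<Rightarrow> 'a measure" where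
  "dirac_sum S I z = distr (count_space I) S z"

definition process_measure ::
  "real measure \<Rightarrow> ('w \<Rightarrow> nat set) \<Rightarrow> ('w \<Rightarrow> nat \<Rightarrow> 'x::polish_space \<times> real) \<Rightarrow> 'w
    \<Rightarrow> ('x \<times> real) measure" where
  "process_measure ell K Z \<omega> = dirac_sum (borel \<Otimes>\<^sub>M ell) (K \<omega>) (Z \<omega>)"

definition point_process ::
  "'w measure \<Rightarrow> real measure \<Rightarrow> ('w \<Rightarrow> nat set) \<Rightarrow> ('w \<Rightarrow> nat \<Rightarrow> 'x::polish_space \<times> real)
    \<Rightarrow> bool" where
  "point_process P ell K Z \<longleftrightarrow>
     prob_space P \<and>
     (\<forall>\<omega>\<in>space P. \<forall>i\<in>K \<omega>. Z \<omega> i \<in> space (borel \<Otimes>\<^sub>M ell)) \<and>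
     (\<forall>\<omega>\<in>space P. \<forall>a b. finite {i \<in> K \<omega>. snd (Z \<omega> i) \<in> {a..b}}) \<and>
     (\<forall>B\<in>sets (borel \<Otimes>\<^sub>M ell).
        (\<lambda>\<omega>. emeasure (process_measure ell K Z \<omega>) B) \<in> borel_measurable P)"

definition time_shift_vimage ::
  "real measure \<Rightarrow> real \<Rightarrow> ('x::polish_space \<times> real) set \<Rightarrow> ('x \<times> real) set" where
  "time_shift_vimage ell t A = (\<lambda>(x, s). (x, s + t)) -` A \<inter> space (borel \<Otimes>\<^sub>M ell)"

definition weakly_time_stationary_L2 ::
  "'w measure \<Rightarrow> real measure \<Rightarrow> ('w \<Rightarrow> nat set) \<Rightarrow> ('w \<Rightarrow> nat \<Rightarrow> 'x::polish_space \<times> real)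
    \<Rightarrow> bool" where
  "weakly_time_stationary_L2 P ell K Z \<longleftrightarrow>
     (let \<Xi> = process_measure ell K Z; shift = time_shift_vimage ell in
      \<forall>A\<in>sets (borel \<Otimes>\<^sub>M ell). \<forall>B\<in>sets (borel \<Otimes>\<^sub>M ell). \<forall>t\<in>space ell.
        bounded A \<and> bounded B \<longrightarrow>
          (\<integral>\<^sup>+ \<omega>. emeasure (\<Xi> \<omega>) (shift t A) \<partial>P) = (\<integral>\<^sup>+ \<omega>. emeasure (\<Xi> \<omega>) A \<partial>P) \<and>
          (\<integral>\<^sup>+ \<omega>. emeasure (\<Xi> \<omega>) A \<partial>P) < \<infinity> \<and>
          (\<integral>\<^sup>+ \<omega>. emeasure (\<Xi> \<omega>) (shift t A) * emeasure (\<Xi> \<omega>) (shift t B) \<partial>P)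
            = (\<integral>\<^sup>+ \<omega>. emeasure (\<Xi> \<omega>) A * emeasure (\<Xi> \<omega>) B \<partial>P) \<and>
          (\<integral>\<^sup>+ \<omega>. emeasure (\<Xi> \<omega>) A * emeasure (\<Xi> \<omega>) B \<partial>P) < \<infinity>)"

definition mean_measure :: "'w measure \<Rightarrow> 'a measure \<Rightarrow> ('w \<Rightarrow> 'a measure) \<Rightarrow> 'a measure" where
  "mean_measure P S R = measure_of (space S) (sets S) (\<lambda>B. \<integral>\<^sup>+ \<omega>. emeasure (R \<omega>) B \<partial>P)"

definition first_moment_measure ::
  "'w measure \<Rightarrow> real measure \<Rightarrow> ('w \<Rightarrow> nat set) \<Rightarrow> ('w \<Rightarrow> nat \<Rightarrow> 'x::polish_space \<times> real)
    \<Rightarrow> ('x \<times> real) measure" where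
  "first_moment_measure P ell K Z =
     mean_measure P (borel \<Otimes>\<^sub>M ell) (process_measure ell K Z)"

text \<open>Second factorial moment measure, on the space of quadruples \<open>(x, y, r, s)\<close>.\<close>

definition factorial_moment_measure ::
  "'w measure \<Rightarrow> real measure \<Rightarrow> ('w \<Rightarrow> nat set) \<Rightarrow> ('w \<Rightarrow> nat \<Rightarrow> 'x::polish_space \<times> real)
    \<Rightarrow> ('x \<times> 'x \<times> real \<times> real) measure" where
  "factorial_moment_measure P ell K Z =
     mean_measure P (borel \<Otimes>\<^sub>M borel \<Otimes>\<^sub>M ell \<Otimes>\<^sub>M ell)
       (\<lambda>\<omega>. dirac_sum (borel \<Otimes>\<^sub>M borel \<Otimes>\<^sub>M ell \<Otimes>\<^sub>M ell)
          {(i, j). i \<in> K \<omega> \<and> j \<in> K \<omega> \<and> i \<noteq> j}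
          (\<lambda>(i, j). (fst (Z \<omega> i), fst (Z \<omega> j), snd (Z \<omega> i), snd (Z \<omega> j))))"

text \<open>The measure \<open>\<mu>\<close> with \<open>M\<^sub>1 = \<mu> \<otimes> ell\<close>.\<close>

definition mark_intensity ::
  "'w measure \<Rightarrow> real measure \<Rightarrow> ('w \<Rightarrow> nat set) \<Rightarrow> ('w \<Rightarrow> nat \<Rightarrow> 'x::polish_space \<times> real)
    \<Rightarrow> 'x measure" where
  "mark_intensity P ell K Z =
     (THE \<mu>. sets \<mu> = sets borel \<and> finite_measure \<mu> \<and>
             first_moment_measure P ell K Z = \<mu> \<Otimes>\<^sub>M ell)"

text \<open>
  The time-reduced factorial moment measure: the locally finite \<open>M\<close> such that the image of the
  factorial moment measure under \<open>(x, y, r, s) \<mapsto> (x, y, r, s - r)\<close> is \<open>ell(dr) M(dx dy ds)\<close>.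
  The second \<open>distr\<close> only brings the coordinates of \<open>ell \<otimes> M\<close> into the order \<open>(x, y, r, s)\<close>.
\<close>

definition reduced_factorial_moment_measure ::
  "'w measure \<Rightarrow> real measure \<Rightarrow> ('w \<Rightarrow> nat set) \<Rightarrow> ('w \<Rightarrow> nat \<Rightarrow> 'x::polish_space \<times> real)
    \<Rightarrow> ('x \<times> 'x \<times> real) measure" where
  "reduced_factorial_moment_measure P ell K Z =
     (THE M. sets M = sets (borel \<Otimes>\<^sub>M borel \<Otimes>\<^sub>M ell) \<and>
             (\<forall>C\<in>sets M. bounded C \<longrightarrow> emeasure M C < \<infinity>) \<and>
             distr (factorial_moment_measure P ell K Z) (borel \<Otimes>\<^sub>M borel \<Otimes>\<^sub>M ell \<Otimes>\<^sub>M ell)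
               (\<lambda>(x, y, r, s). (x, y, r, s - r))
             = distr (ell \<Otimes>\<^sub>M M) (borel \<Otimes>\<^sub>M borel \<Otimes>\<^sub>M ell \<Otimes>\<^sub>M ell)
                 (\<lambda>(r, x, y, s). (x, y, r, s)))"

text \<open>
  The time-reduced factorial covariance measure. It is a signed measure only on sets with bounded
  time component (elsewhere both terms may be infinite); this is the domain on which it is used
  below. On rectangles \<open>A \<times> B \<times> S\<close> the second term is \<open>\<mu>(A) \<mu>(B) ell(S)\<close>.
\<close>

definition reduced_covariance ::
  "'w measure \<Rightarrow> real measure \<Rightarrow> ('w \<Rightarrow> nat set) \<Rightarrow> ('w \<Rightarrow> nat \<Rightarrow> 'x::polish_space \<times> real)
    \<Rightarrow> ('x \<times> 'x \<times> real) set \<Rightarrow> real" where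
  "reduced_covariance P ell K Z C =
     measure (reduced_factorial_moment_measure P ell K Z) C
     - measure (mark_intensity P ell K Z \<Otimes>\<^sub>M mark_intensity P ell K Z \<Otimes>\<^sub>M ell) C"

text \<open>
  \<open>Pos\<close> and \<open>Neg\<close> are mutually singular measures on the sigma-algebra of \<open>S\<close>, finite on the
  sets in \<open>\<C>\<close>, and \<open>\<phi> = Pos - Neg\<close> on \<open>\<C>\<close>. Here \<open>\<C>\<close> is the class of measurable
  sets (those with bounded time component) on which the signed measure \<open>\<phi>\<close> is defined.
\<close>

definition is_jordan_decomposition ::
  "'a measure \<Rightarrow> 'a set set \<Rightarrow> ('a set \<Rightarrow> real) \<Rightarrow> 'a measure \<Rightarrow> 'a measure \<Rightarrow> bool" where
  "is_jordan_decomposition S \<C> \<phi> Pos Neg \<longleftrightarrow>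
     sets Pos = sets S \<and> sets Neg = sets S \<and>
     (\<exists>D\<in>sets S. emeasure Neg D = 0 \<and> emeasure Pos (space S - D) = 0) \<and>
     (\<forall>C\<in>\<C>. emeasure Pos C < \<infinity> \<and> emeasure Neg C < \<infinity> \<and>
              \<phi> C = measure Pos C - measure Neg C)"

definition jordan_positive_part ::
  "'a measure \<Rightarrow> 'a set set \<Rightarrow> ('a set \<Rightarrow> real) \<Rightarrow> 'a measure" where
  "jordan_positive_part S \<C> \<phi> = (THE Pos. \<exists>Neg. is_jordan_decomposition S \<C> \<phi> Pos Neg)"

definition reduced_covariance_pos ::
  "'w measure \<Rightarrow> real measure \<Rightarrow> ('w \<Rightarrow> nat set) \<Rightarrow> ('w \<Rightarrow> nat \<Rightarrow> 'x::polish_space \<times> real)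
    \<Rightarrow> ('x \<times> 'x \<times> real) measure" where
  "reduced_covariance_pos P ell K Z =
     jordan_positive_part (borel \<Otimes>\<^sub>M borel \<Otimes>\<^sub>M ell)
       {C \<in> sets (borel \<Otimes>\<^sub>M borel \<Otimes>\<^sub>M ell). bounded ((\<lambda>(x, y, s). s) ` C)}
       (reduced_covariance P ell K Z)"

definition reduced_covariance_on_pos ::
  "'w measure \<Rightarrow> real measure \<Rightarrow> ('w \<Rightarrow> nat set) \<Rightarrow> ('w \<Rightarrow> nat \<Rightarrow> 'x::polish_space \<times> real)
    \<Rightarrow> 'x set \<Rightarrow> real measure" where
  "reduced_covariance_on_pos P ell K Z A =
     jordan_positive_part ell {S \<in> sets ell. bounded S}
       (\<lambda>S. reduced_covariance P ell K Z (A \<times> A \<times> S))"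

definition measurable_partition :: "nat \<Rightarrow> (nat \<Rightarrow> 'x::topological_space set) \<Rightarrow> bool" where
  "measurable_partition N A \<longleftrightarrow>
     (\<forall>i\<in>{1..N}. A i \<in> sets borel) \<and> disjoint_family_on A {1..N} \<and> (\<Union>i\<in>{1..N}. A i) = UNIV"

end

theory Submission imports Defs begin

text \<open>
  A shift-invariant measure on \<open>ell \<otimes> S\<close> factorizes as \<open>ell \<otimes> M\<close>; this makes \<open>\<mu>\<close> and the
  reduced factorial moment measure well defined. The positive part of a signed measure \<open>\<phi>\<close> is
  \<open>C \<mapsto> \<phi>(C \<inter> D)\<close> for a Hahn set \<open>D\<close> and dominates \<open>\<phi>(B)\<close> for \<open>B \<subseteq> C\<close>, so
  \<open>\<gamma>\<^sup>+\<^sub>A(S) = \<gamma>(A \<times> A \<times> (S \<inter> D)) \<le> \<gamma>\<^sup>+(A \<times> A \<times> S)\<close>, and the sets \<open>A\<^sub>i \<times> A\<^sub>i \<times> S\<close> are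
  disjoint. Both growth bounds come from covering the window by strips of length 2 and
  \<open>a b \<le> a\<^sup>2 + b\<^sup>2\<close>: by stationarity, \<open>E (\<Xi>(H\<^sub>j) \<Xi>(H\<^sub>k)) \<le> 2 E (\<Xi>(H\<^sub>0)\<^sup>2)\<close> for all strips,
  which gives order \<open>t\<close> for one strip paired with the window, and order \<open>t\<^sup>2\<close> for the square.
\<close>

subsection \<open>The time axis\<close>

text \<open>The measures in the statement are definite descriptions, so nothing is known about the
  mark intensity, the reduced moment measure or a positive part until existence and uniqueness are
  proved; most of the work goes there. The obstacle is that the hypotheses speak only of counts of
  bounded sets and of their products: the enumeration of the points need not be measurable, products
  of counts include the pairs i = j, and the reduced covariance is meaningful only on sets of
  bounded time extent. Hence second moments are handled on rectangles and extended along bounded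
  windows, and Jordan decompositions are taken relative to a hereditary class of sets. Length 2 of
  the strips comes from pairs: a first time in (0,1] and a lag in [k,k+1] put the second time in
  (k,k+2]. With c the second moment of the count in one strip, at most 2t strips are used, which
  yields 8 c t^2 for the square and 4 c t for the reduced moment measure. The latter bounds the
  positive part because subtracting the product measure can only decrease it.\<close>

locale time_axis =
  fixes ell :: "real measure"
  assumes ell_cases: "ell = lborel \<or> ell = count_space \<int>"
begin

lemma sigma_finite_ell: "sigma_finite_measure ell"
  using ell_cases
proof
  assume "ell = count_space \<int>"
  then show ?thesis
    by (metis countable_int sigma_finite_measure_count_space_countable)
qed (simp add: sigma_finite_lborel)

sublocale ell: sigma_finite_measure ell
  by (rule sigma_finite_ell)

text \<open>Every set of integers is countable, hence Borel, so both axes carry the trace of the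
  Borel sets. Measurability into \<open>ell\<close> thereby reduces to Borel measurability plus a
  range condition, without further case distinctions.\<close>

lemma sets_ell: "sets ell = sets (restrict_space borel (space ell))"
  using ell_cases
proof
  assume *: "ell = count_space \<int>"
  have int: "countable (\<int> :: real set)"
    using countable_int by (simp add: Ints_def)
  have borel: "A \<in> sets borel" if "A \<subseteq> \<int>" for A :: "real set"
    by (rule sets.countable[OF _ countable_subset[OF that int]]) simp
  have "(\<inter>) \<int> ` sets borel = (Pow \<int> :: real set set)"
  proof (intro antisym subsetI)
    fix A :: "real set" assume "A \<in> Pow \<int>"
    then show "A \<in> (\<inter>) \<int> ` sets borel"
      using borel[of A] by (intro image_eqI[of _ _ A]) auto
  qed auto
  then show ?thesis
    by (simp add: * sets_restrict_space)
qed simp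

lemma
  shows zero_in_ell: "0 \<in> space ell"
    and add_in_ell: "r \<in> space ell \<Longrightarrow> s \<in> space ell \<Longrightarrow> r + s \<in> space ell"
    and minus_in_ell: "r \<in> space ell \<Longrightarrow> - r \<in> space ell"
    and diff_in_ell: "r \<in> space ell \<Longrightarrow> s \<in> space ell \<Longrightarrow> r - s \<in> space ell"
  using ell_cases by auto

lemma of_nat_in_ell: "real n \<in> space ell"
  using ell_cases by auto

lemma ident_measurable_ell [measurable]: "(\<lambda>s. s) \<in> ell \<rightarrow>\<^sub>M borel"
  unfolding measurable_cong_sets[OF sets_ell refl] by (rule measurable_restrict_space1) simp

lemma measurable_ellI:
  assumes "f \<in> borel_measurable M" "\<And>x. x \<in> space M \<Longrightarrow> f x \<in> space ell"
  shows "f \<in> M \<rightarrow>\<^sub>M ell"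
  unfolding measurable_cong_sets[OF refl sets_ell]
  using assms by (intro measurable_restrict_space2) auto

lemma borel_measurable_ellD: "f \<in> M \<rightarrow>\<^sub>M ell \<Longrightarrow> f \<in> borel_measurable M"
  using measurable_compose[OF _ ident_measurable_ell] by simp

lemma measurable_ell_add [measurable]:
  assumes f: "f \<in> M \<rightarrow>\<^sub>M ell" and g: "g \<in> M \<rightarrow>\<^sub>M ell"
  shows "(\<lambda>x. f x + g x) \<in> M \<rightarrow>\<^sub>M ell"
  using f[THEN measurable_space] g[THEN measurable_space] f[THEN borel_measurable_ellD]
    g[THEN borel_measurable_ellD]
  by (intro measurable_ellI) (auto intro: add_in_ell)

lemma measurable_ell_diff [measurable]:
  assumes f: "f \<in> M \<rightarrow>\<^sub>M ell" and g: "g \<in> M \<rightarrow>\<^sub>M ell"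
  shows "(\<lambda>x. f x - g x) \<in> M \<rightarrow>\<^sub>M ell"
  using f[THEN measurable_space] g[THEN measurable_space] f[THEN borel_measurable_ellD]
    g[THEN borel_measurable_ellD]
  by (intro measurable_ellI) (auto intro: diff_in_ell)

lemma Int_space_ell [measurable, simp]: "B \<in> sets borel \<Longrightarrow> B \<inter> space ell \<in> sets ell"
  unfolding sets_ell by (auto simp: sets_restrict_space)

lemma UN_centered_intervals: "(\<Union>n::nat. {- real n..real n} \<inter> space ell) = space ell"
proof -
  have "\<exists>n::nat. - real n \<le> s \<and> s \<le> real n" for s :: real
    using real_arch_simple[of "\<bar>s\<bar>"] by (auto simp: abs_le_iff intro: minus_le_iff[THEN iffD1])
  then show ?thesis
    by auto
qed

lemma nn_integral_ell_translate:
  assumes [measurable]: "f \<in> borel_measurable ell" and t: "t \<in> space ell"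
  shows "(\<integral>\<^sup>+s. f (t + s) \<partial>ell) = (\<integral>\<^sup>+s. f s \<partial>ell)"
  using ell_cases
proof
  assume *: "ell = lborel"
  then have "f \<in> borel_measurable borel"
    using assms by simp
  then show ?thesis
    using nn_integral_real_affine[of f 1 t] by (simp add: *)
next
  assume *: "ell = count_space \<int>"
  have "bij_betw ((+) t) \<int> \<int>"
    using t * by (intro bij_betwI[where g = "\<lambda>s. s - t"]) auto
  then show ?thesis
    unfolding * by (rule nn_integral_bij_count_space)
qed

lemma emeasure_ell_bounded:
  assumes "bounded S"
  shows "emeasure ell S < \<infinity>"
  using ell_cases
proof
  assume "ell = lborel"
  then show ?thesis
    using emeasure_bounded_finite[OF assms] by simp
next
  assume *: "ell = count_space \<int>"
  show ?thesis
  proof (cases "S \<subseteq> \<int>")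
    case True
    from assms obtain a where a: "\<And>x. x \<in> S \<Longrightarrow> \<bar>x\<bar> \<le> a"
      by (auto simp: bounded_iff)
    have "S \<subseteq> real_of_int ` {- \<lceil>a\<rceil>..\<lceil>a\<rceil>}"
    proof
      fix x assume x: "x \<in> S"
      with True obtain k where "x = of_int k" by (auto elim: Ints_cases)
      with a[OF x] show "x \<in> real_of_int ` {- \<lceil>a\<rceil>..\<lceil>a\<rceil>}"
        by (auto intro!: imageI simp: abs_le_iff) linarith+
    qed
    then have "finite S" by (rule finite_subset) simp
    then show ?thesis
      using True by (simp add: * emeasure_count_space of_nat_less_top)
  \<comment> \<open>A set with a non-integer element is not measurable for
    \<open>count_space \<int>\<close>, and there \<open>emeasure\<close> has the default value
    0.\<close>
  qed (simp add: * emeasure_notin_sets)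
qed

text \<open>The interval is half-open so that it has mass 1 on both axes; the closed one contains
  two integers.\<close>

lemma emeasure_ell_unit: "emeasure ell ({-1..<0} \<inter> space ell) = 1"
  using ell_cases
proof
  assume *: "ell = count_space \<int>"
  have "{-1..<0} \<inter> \<int> = {-1::real}"
    by (auto elim!: Ints_cases)
  then show ?thesis
    by (simp add: *)
qed simp

text \<open>
  A measure invariant under shifts of the time coordinate is averaged over the shifts by
  \<open>s \<in> [-1, 0)\<close>; Fubini then splits off the factor \<open>ell\<close>.
\<close>

lemma shift_invariant_disintegration:
  fixes S :: "'a measure" and \<nu> :: "(real \<times> 'a) measure"
  assumes sets_\<nu>: "sets \<nu> = sets (ell \<Otimes>\<^sub>M S)"
    and inv: "\<And>t. t \<in> space ell \<Longrightarrow> distr \<nu> (ell \<Otimes>\<^sub>M S) (\<lambda>(r, c). (r + t, c)) = \<nu>"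
    and F: "range F \<subseteq> sets S" "(\<Union>n::nat. F n) = space S"
    and fin: "\<And>(m::nat) n. emeasure \<nu> (({- real m..real m} \<inter> space ell) \<times> F n) < \<infinity>"
  obtains M where "sets M = sets S" "sigma_finite_measure M" "\<nu> = ell \<Otimes>\<^sub>M M"
    "\<And>C. C \<in> sets S \<Longrightarrow> emeasure M C = emeasure \<nu> (({0<..1} \<inter> space ell) \<times> C)"
proof -
  note [measurable_cong] = sets_\<nu>
  have [simp]: "space \<nu> = space ell \<times> space S"
    using sets_eq_imp_space_eq[OF sets_\<nu>] by (simp add: space_pair_measure)
  have F_sets [measurable]: "F n \<in> sets S" for n
    using F by auto
  interpret \<nu>: sigma_finite_measure \<nu>
  proof
    let ?A = "(\<lambda>(m::nat, n). ({- real m..real m} \<inter> space ell) \<times> F n) ` UNIV"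
    have "\<exists>m n. - real m \<le> r \<and> r \<le> real m \<and> c \<in> F n" if c: "c \<in> space S" for r c
    proof -
      obtain m :: nat where "\<bar>r\<bar> \<le> real m"
        using real_arch_simple by blast
      moreover obtain n where "c \<in> F n"
        using c F(2) by auto
      ultimately have "- real m \<le> r \<and> r \<le> real m \<and> c \<in> F n"
        by (simp add: abs_le_iff)
      then show ?thesis
        by blast
    qed
    moreover have "\<Union>?A \<subseteq> space ell \<times> space S"
      using F(2) by auto
    ultimately have "\<Union>?A = space \<nu>"
      by (auto 0 3)
    then show "\<exists>A. countable A \<and> A \<subseteq> sets \<nu> \<and> \<Union>A = space \<nu> \<and> (\<forall>a\<in>A. emeasure \<nu> a \<noteq> \<infinity>)"
      using fin by (intro exI[of _ ?A]) (auto simp: less_top)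
  qed
  interpret ell_\<nu>: pair_sigma_finite ell \<nu> ..
  \<comment> \<open>\<open>U\<close> is the mirror image of the averaging set [-1,0); the reflection
    arises from the substitution below, which turns a shift \<open>s\<close> into
    \<open>u - r\<close>.\<close>
  define U where "U = {0<..1} \<inter> space ell"
  have [measurable]: "U \<in> sets ell"
    by (simp add: U_def)
  define M where "M = distr (density \<nu> (\<lambda>(r, c). indicator U r)) S snd"
  have sets_M [measurable_cong]: "sets M = sets S"
    by (simp add: M_def)
  have M: "emeasure M C = emeasure \<nu> (U \<times> C)" if C[measurable]: "C \<in> sets S" for C
  proof -
    have "emeasure M C = (\<integral>\<^sup>+x. (case x of (r, c) \<Rightarrow> indicator U r) * indicator (snd -` C \<inter> space \<nu>) x \<partial>\<nu>)"
      unfolding M_def by (simp add: emeasure_distr emeasure_density)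
    also have "\<dots> = (\<integral>\<^sup>+x. indicator (U \<times> C) x \<partial>\<nu>)"
      by (intro nn_integral_cong) (auto simp: indicator_def)
    finally show ?thesis
      by simp
  qed
  interpret M: sigma_finite_measure M
  proof
    have "emeasure M (F n) < \<infinity>" for n
    proof -
      have "emeasure \<nu> (U \<times> F n) \<le> emeasure \<nu> (({- real 1..real 1} \<inter> space ell) \<times> F n)"
        by (intro emeasure_mono) (auto simp: U_def)
      then show ?thesis
        using fin[of 1 n] by (simp add: M order.strict_trans1)
    qed
    then show "\<exists>A. countable A \<and> A \<subseteq> sets M \<and> \<Union>A = space M \<and> (\<forall>a\<in>A. emeasure M a \<noteq> \<infinity>)"
      using F sets_eq_imp_space_eq[OF sets_M]
      by (intro exI[of _ "range F"]) (auto simp: sets_M less_top)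
  qed
  have int_inv: "(\<integral>\<^sup>+x. f (fst x + t) (snd x) \<partial>\<nu>) = (\<integral>\<^sup>+x. f (fst x) (snd x) \<partial>\<nu>)"
    if t: "t \<in> space ell" and f[measurable]: "case_prod f \<in> borel_measurable (ell \<Otimes>\<^sub>M S)" for f t
  proof -
    have [measurable]: "t \<in> space ell" by fact
    have "(\<integral>\<^sup>+x. f (fst x) (snd x) \<partial>\<nu>)
        = (\<integral>\<^sup>+x. f (fst x) (snd x) \<partial>distr \<nu> (ell \<Otimes>\<^sub>M S) (\<lambda>(r, c). (r + t, c)))"
      by (simp add: inv[OF t])
    also have "\<dots> = (\<integral>\<^sup>+x. f (fst x + t) (snd x) \<partial>\<nu>)"
      by (subst nn_integral_distr) (auto simp: split_beta')
    finally show ?thesis ..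
  qed
  have "\<nu> = ell \<Otimes>\<^sub>M M"
  proof (rule measure_eqI)
    show "sets \<nu> = sets (ell \<Otimes>\<^sub>M M)"
      using sets_\<nu> sets_M by (metis sets_pair_measure_cong)
  next
    fix E assume "E \<in> sets \<nu>"
    then have [measurable]: "E \<in> sets (ell \<Otimes>\<^sub>M S)" "E \<in> sets (ell \<Otimes>\<^sub>M M)"
      using sets_\<nu> sets_M by (auto cong: sets_pair_measure_cong)
    define V where "V = {-1..<0} \<inter> space ell"
    have [measurable]: "V \<in> sets ell"
      by (simp add: V_def)
    let ?V = "indicator V :: real \<Rightarrow> ennreal"
    let ?E = "\<lambda>r c. indicator E (r, c) :: ennreal"
    have "emeasure \<nu> E = (\<integral>\<^sup>+s. ?V s * emeasure \<nu> E \<partial>ell)"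
      by (simp add: nn_integral_multc V_def emeasure_ell_unit)
    also have "\<dots> = (\<integral>\<^sup>+s. \<integral>\<^sup>+x. ?V s * ?E (fst x + s) (snd x) \<partial>\<nu> \<partial>ell)"
    proof (rule nn_integral_cong)
      fix s assume s [measurable]: "s \<in> space ell"
      have "(\<integral>\<^sup>+x. ?V s * ?E (fst x + s) (snd x) \<partial>\<nu>) = ?V s * (\<integral>\<^sup>+x. ?E (fst x + s) (snd x) \<partial>\<nu>)"
        by (rule nn_integral_cmult) measurable
      also have "(\<integral>\<^sup>+x. ?E (fst x + s) (snd x) \<partial>\<nu>) = (\<integral>\<^sup>+x. ?E (fst x) (snd x) \<partial>\<nu>)"
        by (rule int_inv[OF s, of ?E]) measurable
      finally show "?V s * emeasure \<nu> E = (\<integral>\<^sup>+x. ?V s * ?E (fst x + s) (snd x) \<partial>\<nu>)"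
        by simp
    qed
    also have "\<dots> = (\<integral>\<^sup>+x. \<integral>\<^sup>+s. ?V s * ?E (fst x + s) (snd x) \<partial>ell \<partial>\<nu>)"
      by (rule ell_\<nu>.Fubini'[symmetric]) measurable
    \<comment> \<open>Substitution \<open>u = fst x + s\<close> in the inner integral, so that the
      time coordinate of \<open>E\<close> becomes a free variable, independent of
      \<open>x\<close>.\<close>
    also have "\<dots> = (\<integral>\<^sup>+x. \<integral>\<^sup>+u. ?V (u - fst x) * ?E u (snd x) \<partial>ell \<partial>\<nu>)"
    proof (rule nn_integral_cong)
      fix x assume "x \<in> space \<nu>"
      then have [measurable]: "fst x \<in> space ell" "snd x \<in> space S"
        by auto
      show "(\<integral>\<^sup>+s. ?V s * ?E (fst x + s) (snd x) \<partial>ell) = (\<integral>\<^sup>+u. ?V (u - fst x) * ?E u (snd x) \<partial>ell)"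
        using nn_integral_ell_translate[of "\<lambda>u. ?V (u - fst x) * ?E u (snd x)" "fst x"]
          \<open>fst x \<in> space ell\<close> by simp
    qed
    also have "\<dots> = (\<integral>\<^sup>+u. \<integral>\<^sup>+x. ?V (u - fst x) * ?E u (snd x) \<partial>\<nu> \<partial>ell)"
      by (rule ell_\<nu>.Fubini') measurable
    also have "\<dots> = (\<integral>\<^sup>+u. \<integral>\<^sup>+c. ?E u c \<partial>M \<partial>ell)"
    proof (rule nn_integral_cong)
      fix u assume u [measurable]: "u \<in> space ell"
      have [measurable]: "0 \<in> space ell"
        by (rule zero_in_ell)
      \<comment> \<open>Shifting by \<open>u\<close> removes \<open>u\<close> from the weight:
        \<open>u - (r + u) = - r\<close>, and this lies in [-1,0) exactly when \<open>r\<close> lies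
        in (0,1].\<close>
      have "(\<integral>\<^sup>+x. ?V (u - fst x) * ?E u (snd x) \<partial>\<nu>)
          = (\<integral>\<^sup>+x. ?V (u - (fst x + u)) * ?E u (snd x) \<partial>\<nu>)"
        by (rule int_inv[OF u, of "\<lambda>r c. ?V (u - r) * ?E u c", symmetric]) measurable
      also have "\<dots> = (\<integral>\<^sup>+x. (case x of (r, c) \<Rightarrow> indicator U r) * ?E u (snd x) \<partial>\<nu>)"
      proof (rule nn_integral_cong)
        fix x assume "x \<in> space \<nu>"
        then have "- fst x \<in> space ell \<longleftrightarrow> fst x \<in> space ell"
          using minus_in_ell by auto
        then show "?V (u - (fst x + u)) * ?E u (snd x) = (case x of (r, c) \<Rightarrow> indicator U r) * ?E u (snd x)"
          by (auto simp: U_def V_def indicator_def split: prod.splits)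
      qed
      also have "\<dots> = (\<integral>\<^sup>+c. ?E u c \<partial>M)"
        unfolding M_def by (simp add: nn_integral_distr nn_integral_density)
      finally show "(\<integral>\<^sup>+x. ?V (u - fst x) * ?E u (snd x) \<partial>\<nu>) = (\<integral>\<^sup>+c. ?E u c \<partial>M)" .
    qed
    also have "\<dots> = emeasure (ell \<Otimes>\<^sub>M M) E"
      by (rule M.emeasure_pair_measure[symmetric]) measurable
    finally show "emeasure \<nu> E = emeasure (ell \<Otimes>\<^sub>M M) E" .
  qed
  then show thesis
    using that sets_M M M.sigma_finite_measure_axioms by (auto simp: U_def)
qed

end

subsection \<open>Mean measures and sums of Dirac measures\<close>

lemma sets_mean_measure [simp, measurable_cong]: "sets (mean_measure P S R) = sets S"
  and space_mean_measure [simp]: "space (mean_measure P S R) = space S"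
  by (simp_all add: mean_measure_def)

text \<open>Sum and expectation may be exchanged, so the set function is countably additive, which
  is what lets \<open>measure_of\<close> return it.\<close>

lemma emeasure_mean_measure:
  assumes sets_R: "\<And>\<omega>. \<omega> \<in> space P \<Longrightarrow> sets (R \<omega>) = sets S"
    and meas: "\<And>B. B \<in> sets S \<Longrightarrow> (\<lambda>\<omega>. emeasure (R \<omega>) B) \<in> borel_measurable P"
    and B: "B \<in> sets S"
  shows "emeasure (mean_measure P S R) B = (\<integral>\<^sup>+\<omega>. emeasure (R \<omega>) B \<partial>P)"
  unfolding mean_measure_def
proof (rule emeasure_measure_of_sigma)
  show "countably_additive (sets S) (\<lambda>B. \<integral>\<^sup>+\<omega>. emeasure (R \<omega>) B \<partial>P)"
  proof (rule countably_additiveI)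
    fix A :: "nat \<Rightarrow> 'b set"
    assume A: "range A \<subseteq> sets S" "disjoint_family A"
    have "(\<Sum>i. \<integral>\<^sup>+\<omega>. emeasure (R \<omega>) (A i) \<partial>P) = (\<integral>\<^sup>+\<omega>. (\<Sum>i. emeasure (R \<omega>) (A i)) \<partial>P)"
      using A by (intro nn_integral_suminf[symmetric] meas) auto
    also have "\<dots> = (\<integral>\<^sup>+\<omega>. emeasure (R \<omega>) (\<Union>i. A i) \<partial>P)"
      using A sets_R by (intro nn_integral_cong suminf_emeasure) auto
    finally show "(\<Sum>i. \<integral>\<^sup>+\<omega>. emeasure (R \<omega>) (A i) \<partial>P) = (\<integral>\<^sup>+\<omega>. emeasure (R \<omega>) (\<Union>i. A i) \<partial>P)" .
  qed
qed (use B in \<open>auto simp: positive_def sets.sigma_algebra_axioms\<close>)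

lemma sets_dirac_sum [simp, measurable_cong]: "sets (dirac_sum S I z) = sets S"
  and space_dirac_sum [simp]: "space (dirac_sum S I z) = space S"
  by (simp_all add: dirac_sum_def)

lemma emeasure_dirac_sum:
  assumes "\<And>i. i \<in> I \<Longrightarrow> z i \<in> space S" "B \<in> sets S"
  shows "emeasure (dirac_sum S I z) B = emeasure (count_space I) {i \<in> I. z i \<in> B}"
  using assms unfolding dirac_sum_def
  by (subst emeasure_distr) (auto intro!: arg_cong2[where f = emeasure])

subsection \<open>Jordan decompositions\<close>

text \<open>Together the two parts say that Pos(C) is the maximum of
  \<open>ennreal (\<phi> B)\<close> over measurable B inside C, attained at the intersection with
  the Hahn set. Neg no longer occurs. The class is hereditary so that \<phi> may be evaluated on
  these subsets; \<open>ennreal\<close> truncates negative values to 0.\<close>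

lemma is_jordan_decompositionD:
  assumes J: "is_jordan_decomposition S \<C> \<phi> Pos Neg"
    and \<C>: "\<C> \<subseteq> sets S" "\<forall>C\<in>\<C>. \<forall>B\<in>sets S. B \<subseteq> C \<longrightarrow> B \<in> \<C>"
  shows "\<exists>D\<in>sets S. \<forall>C\<in>\<C>. emeasure Pos C = ennreal (\<phi> (C \<inter> D))"
    and "C \<in> \<C> \<Longrightarrow> B \<in> sets S \<Longrightarrow> B \<subseteq> C \<Longrightarrow> ennreal (\<phi> B) \<le> emeasure Pos C"
proof -
  from J obtain D where sets: "sets Pos = sets S" "sets Neg = sets S"
    and D: "D \<in> sets S" "emeasure Neg D = 0" "emeasure Pos (space S - D) = 0"
    and fin: "\<And>C. C \<in> \<C> \<Longrightarrow> emeasure Pos C < \<infinity>" "\<And>C. C \<in> \<C> \<Longrightarrow> emeasure Neg C < \<infinity>"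
    and \<phi>: "\<And>C. C \<in> \<C> \<Longrightarrow> \<phi> C = measure Pos C - measure Neg C"
    unfolding is_jordan_decomposition_def by blast
  have "emeasure Pos C = ennreal (\<phi> (C \<inter> D))" if C: "C \<in> \<C>" for C
  proof -
    have CS: "C \<in> sets S"
      using C \<C>(1) by auto
    have CD: "C \<inter> D \<in> \<C>"
      using \<C>(2)[rule_format, OF C, of "C \<inter> D"] CS D(1) by simp
    have "emeasure Neg (C \<inter> D) \<le> emeasure Neg D"
      using D(1) sets by (intro emeasure_mono) auto
    then have Neg: "measure Neg (C \<inter> D) = 0"
      using D(2) by (simp add: measure_def)
    have "emeasure Pos (C - D) \<le> emeasure Pos (space S - D)"
      using D(1) sets sets.sets_into_space[OF CS] by (intro emeasure_mono) auto
    then have "emeasure Pos (C - D) = 0"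
      using D(3) by simp
    moreover have "emeasure Pos C = emeasure Pos (C \<inter> D) + emeasure Pos (C - D)"
      using CS D(1) sets by (subst plus_emeasure) (auto intro!: arg_cong2[where f = emeasure])
    ultimately have "emeasure Pos C = emeasure Pos (C \<inter> D)"
      by simp
    then show ?thesis
      using \<phi>[OF CD] Neg fin(1)[OF CD] by (simp add: emeasure_eq_ennreal_measure less_top)
  qed
  with D(1) show "\<exists>D\<in>sets S. \<forall>C\<in>\<C>. emeasure Pos C = ennreal (\<phi> (C \<inter> D))"
    by blast
  show "ennreal (\<phi> B) \<le> emeasure Pos C" if "C \<in> \<C>" "B \<in> sets S" "B \<subseteq> C"
  proof -
    have B: "B \<in> \<C>"
      using \<C>(2)[rule_format, OF that] .
    have "ennreal (\<phi> B) \<le> ennreal (measure Pos B)"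
      using \<phi>[OF B] by (intro ennreal_leI) simp
    also have "\<dots> = emeasure Pos B"
      using fin(1)[OF B] by (simp add: emeasure_eq_ennreal_measure less_top)
    also have "\<dots> \<le> emeasure Pos C"
      using that \<C>(1) sets by (intro emeasure_mono) auto
    finally show ?thesis .
  qed
qed

text \<open>On the class, Pos is a maximum that depends on \<phi> alone. Elsewhere \<phi> says
  nothing, and the values are recovered by continuity from below along \<open>F\<close>.\<close>

lemma jordan_decomposition_unique:
  assumes J: "is_jordan_decomposition S \<C> \<phi> Pos Neg" "is_jordan_decomposition S \<C> \<phi> Pos' Neg'"
    and \<C>: "\<C> \<subseteq> sets S" "\<forall>C\<in>\<C>. \<forall>B\<in>sets S. B \<subseteq> C \<longrightarrow> B \<in> \<C>"
    and F: "range F \<subseteq> \<C>" "incseq F" "(\<Union>n::nat. F n) = space S"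
  shows "Pos = Pos'"
proof -
  have le: "emeasure P C \<le> emeasure P' C"
    if J1: "is_jordan_decomposition S \<C> \<phi> P N" and J2: "is_jordan_decomposition S \<C> \<phi> P' N'" and C: "C \<in> \<C>" for P N P' N' C
  proof -
    obtain D where D: "D \<in> sets S" "emeasure P C = ennreal (\<phi> (C \<inter> D))"
      using is_jordan_decompositionD(1)[OF J1 \<C>] C by blast
    have "C \<inter> D \<in> sets S"
      using C \<C>(1) D(1) by auto
    then show ?thesis
      unfolding D(2) using is_jordan_decompositionD(2)[OF J2 \<C> C] by simp
  qed
  have eq: "emeasure Pos C = emeasure Pos' C" if "C \<in> \<C>" for C
    using le[OF J that] le[OF J(2,1) that] by simp
  have sets: "sets Pos = sets S" "sets Pos' = sets S"
    using J by (auto simp: is_jordan_decomposition_def)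
  show ?thesis
  proof (rule measure_eqI)
    fix A assume "A \<in> sets Pos"
    then have A: "A \<in> sets S"
      by (simp add: sets)
    have in_\<C>: "A \<inter> F n \<in> \<C>" for n
      using \<C>(2)[rule_format, of "F n" "A \<inter> F n"] F(1) A \<C>(1) by auto
    have "incseq (\<lambda>n. A \<inter> F n)"
      using F(2) by (auto simp: incseq_def)
    moreover have "range (\<lambda>n. A \<inter> F n) \<subseteq> sets S"
      using in_\<C> \<C>(1) by auto
    ultimately have "emeasure M A = (SUP n. emeasure M (A \<inter> F n))" if "sets M = sets S" for M
      using F(3) sets.sets_into_space[OF A] that
      by (subst SUP_emeasure_incseq) (auto intro!: arg_cong2[where f = emeasure])
    then show "emeasure Pos A = emeasure Pos' A"
      using eq[OF in_\<C>] sets by simp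
  qed (simp add: sets)
qed

text \<open>
  With respect to a common dominating measure, \<open>M\<close> and \<open>N\<close> have densities \<open>f\<close> and \<open>g\<close>; the
  decomposition is given by the positive parts of \<open>f - g\<close> and \<open>g - f\<close>. The case distinctions
  are needed since \<open>top - top = top\<close> in \<open>ennreal\<close>.
\<close>

lemma jordan_decomposition_exists:
  assumes sets_M: "sets M = sets S" and sets_N: "sets N = sets S"
    and F: "range F \<subseteq> sets S" "(\<Union>n::nat. F n) = space S"
    and fin_F: "\<And>n. emeasure M (F n) < \<infinity>" "\<And>n. emeasure N (F n) < \<infinity>"
    and \<C>: "\<C> \<subseteq> sets S" "\<And>C. C \<in> \<C> \<Longrightarrow> emeasure M C < \<infinity>" "\<And>C. C \<in> \<C> \<Longrightarrow> emeasure N C < \<infinity>"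
    and \<phi>: "\<And>C. C \<in> \<C> \<Longrightarrow> \<phi> C = measure M C - measure N C"
  shows "\<exists>Pos Neg. is_jordan_decomposition S \<C> \<phi> Pos Neg"
proof -
  \<comment> \<open>This is the measure M + N, written as an integral of measures over the two
    booleans with counting measure.\<close>
  define \<rho> where "\<rho> = mean_measure (count_space UNIV) S (\<lambda>b. if b then M else N)"
  have sets_\<rho> [measurable_cong]: "sets \<rho> = sets S"
    by (simp add: \<rho>_def)
  have \<rho>: "emeasure \<rho> A = emeasure M A + emeasure N A" if "A \<in> sets S" for A
    unfolding \<rho>_def
    by (subst emeasure_mean_measure)
      (use that in \<open>auto simp: sets_M sets_N nn_integral_count_space_finite UNIV_bool\<close>)
  interpret \<rho>: sigma_finite_measure \<rho>
  proof
    show "\<exists>A. countable A \<and> A \<subseteq> sets \<rho> \<and> \<Union>A = space \<rho> \<and> (\<forall>a\<in>A. emeasure \<rho> a \<noteq> \<infinity>)"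
      using F fin_F by (intro exI[of _ "range F"]) (auto simp: \<rho>_def[symmetric] sets_\<rho> \<rho> less_top sets_eq_imp_space_eq[OF sets_\<rho>] image_subset_iff)
  qed
  have ac: "absolutely_continuous \<rho> M" "absolutely_continuous \<rho> N"
    by (auto simp: absolutely_continuous_def null_sets_def sets_\<rho> sets_M sets_N \<rho>)
  obtain f where [measurable]: "f \<in> borel_measurable \<rho>" and f: "density \<rho> f = M"
    using \<rho>.Radon_Nikodym[OF ac(1)] sets_M sets_\<rho> by auto
  obtain g where [measurable]: "g \<in> borel_measurable \<rho>" and g: "density \<rho> g = N"
    using \<rho>.Radon_Nikodym[OF ac(2)] sets_N sets_\<rho> by auto
  define Pos where "Pos = density \<rho> (\<lambda>x. if g x < f x then f x - g x else 0)"
  define Neg where "Neg = density \<rho> (\<lambda>x. if f x < g x then g x - f x else 0)"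
  define D where "D = {x \<in> space \<rho>. g x \<le> f x}"
  have D [measurable]: "D \<in> sets \<rho>"
    unfolding D_def by measurable
  \<comment> \<open>The relation is kept in additive form because the values may be infinite; it is
    turned into a difference only on the class, where all four are finite.\<close>
  have add: "emeasure M C + emeasure Neg C = emeasure N C + emeasure Pos C"
    and le: "emeasure Pos C \<le> emeasure M C" "emeasure Neg C \<le> emeasure N C" if "C \<in> sets S" for C
  proof -
    have [measurable]: "C \<in> sets \<rho>"
      using that by (simp add: sets_\<rho>)
    \<comment> \<open>Both sides are the maximum of \<open>x\<close> and \<open>y\<close>.\<close>
    have "x + (if x < y then y - x else 0) = y + (if y < x then x - y else 0)" for x y :: ennreal
      by (cases x y rule: linorder_cases) (auto simp: add_diff_inverse_ennreal dest: less_asym)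
    then have *: "f x * indicator C x + (if f x < g x then g x - f x else 0) * indicator C x
        = g x * indicator C x + (if g x < f x then f x - g x else 0) * indicator C x" for x
      by (simp only: distrib_right[symmetric])
    show "emeasure M C + emeasure Neg C = emeasure N C + emeasure Pos C"
      unfolding f[symmetric] g[symmetric] Pos_def Neg_def
      by (simp add: emeasure_density nn_integral_add[symmetric] *)
    have diff_le: "(if y < x then x - y else 0) \<le> x" for x y :: ennreal
      by (simp add: diff_le_self_ennreal)
    show "emeasure Pos C \<le> emeasure M C" "emeasure Neg C \<le> emeasure N C"
      unfolding f[symmetric] g[symmetric] Pos_def Neg_def
      by (auto simp: emeasure_density intro!: nn_integral_mono mult_right_mono diff_le)
  qed
  have "is_jordan_decomposition S \<C> \<phi> Pos Neg"
    unfolding is_jordan_decomposition_def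
  proof (intro conjI ballI bexI)
    show "emeasure Neg D = 0"
      unfolding Neg_def
      by (subst emeasure_density) (auto simp: nn_integral_0_iff_AE D_def indicator_def intro!: AE_I2)
    show "emeasure Pos (space S - D) = 0"
      unfolding Pos_def
      by (subst emeasure_density) (auto simp: nn_integral_0_iff_AE D_def indicator_def sets_eq_imp_space_eq[OF sets_\<rho>, symmetric] intro!: AE_I2)
  next
    fix C assume C: "C \<in> \<C>"
    then have CS: "C \<in> sets S"
      using \<C>(1) by auto
    show fin: "emeasure Pos C < \<infinity>" "emeasure Neg C < \<infinity>"
      using le[OF CS] \<C>(2,3)[OF C] by (auto intro: le_less_trans)
    have "measure M C + measure Neg C = measure N C + measure Pos C"
      using arg_cong[OF add[OF CS], of enn2real] fin \<C>(2,3)[OF C]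
      by (simp add: enn2real_plus measure_def)
    then show "\<phi> C = measure Pos C - measure Neg C"
      using \<phi>[OF C] by simp
  qed (use D in \<open>simp_all add: Pos_def Neg_def sets_\<rho>\<close>)
  then show ?thesis
    by blast
qed

text \<open>Existence and uniqueness combined: the definite description in
  \<open>jordan_positive_part\<close> denotes a genuine positive part. These three facts are the
  interface through which positive parts are used from here on.\<close>

lemma
  assumes sets: "sets M = sets S" "sets N = sets S"
    and \<C>: "\<C> \<subseteq> sets S" "\<forall>C\<in>\<C>. \<forall>B\<in>sets S. B \<subseteq> C \<longrightarrow> B \<in> \<C>"
    and fin: "\<And>C. C \<in> \<C> \<Longrightarrow> emeasure M C < \<infinity>" "\<And>C. C \<in> \<C> \<Longrightarrow> emeasure N C < \<infinity>"
    and \<phi>: "\<And>C. C \<in> \<C> \<Longrightarrow> \<phi> C = measure M C - measure N C"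
    and F: "range F \<subseteq> \<C>" "incseq F" "(\<Union>n::nat. F n) = space S"
  shows sets_jordan_positive_part: "sets (jordan_positive_part S \<C> \<phi>) = sets S"
    and jordan_positive_part_eq:
      "\<exists>D\<in>sets S. \<forall>C\<in>\<C>. emeasure (jordan_positive_part S \<C> \<phi>) C = ennreal (\<phi> (C \<inter> D))"
    and jordan_positive_part_ge:
      "C \<in> \<C> \<Longrightarrow> B \<in> sets S \<Longrightarrow> B \<subseteq> C \<Longrightarrow> ennreal (\<phi> B) \<le> emeasure (jordan_positive_part S \<C> \<phi>) C"
proof -
  obtain Pos Neg where J: "is_jordan_decomposition S \<C> \<phi> Pos Neg"
    using jordan_decomposition_exists[OF sets _ F(3) _ _ \<C>(1) fin \<phi>] F(1) \<C>(1) fin by blast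
  have "jordan_positive_part S \<C> \<phi> = Pos"
    unfolding jordan_positive_part_def
  proof (rule the_equality)
    show "Pos' = Pos" if "\<exists>Neg'. is_jordan_decomposition S \<C> \<phi> Pos' Neg'" for Pos'
      using that jordan_decomposition_unique[OF _ J \<C> F] by metis
  qed (use J in blast)
  then show "sets (jordan_positive_part S \<C> \<phi>) = sets S"
    "\<exists>D\<in>sets S. \<forall>C\<in>\<C>. emeasure (jordan_positive_part S \<C> \<phi>) C = ennreal (\<phi> (C \<inter> D))"
    "C \<in> \<C> \<Longrightarrow> B \<in> sets S \<Longrightarrow> B \<subseteq> C \<Longrightarrow> ennreal (\<phi> B) \<le> emeasure (jordan_positive_part S \<C> \<phi>) C"
    using is_jordan_decompositionD[OF J \<C>] J by (auto simp: is_jordan_decomposition_def)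
qed

subsection \<open>Moment measures of a stationary process\<close>

locale stationary_process = time_axis ell
  for ell :: "real measure" +
  fixes P :: "'w measure"
    and K :: "'w \<Rightarrow> nat set"
    and Z :: "'w \<Rightarrow> nat \<Rightarrow> 'x::polish_space \<times> real"
  assumes bounded_marks: "bounded (UNIV :: 'x set)"
    and point_process: "point_process P ell K Z"
    and stationary: "weakly_time_stationary_L2 P ell K Z"
begin

sublocale prob_space P
  using point_process by (simp add: point_process_def)

abbreviation XT :: "('x \<times> real) measure" where
  "XT \<equiv> borel \<Otimes>\<^sub>M ell"

abbreviation N :: "('x \<times> real) set \<Rightarrow> 'w \<Rightarrow> ennreal" where
  "N B \<omega> \<equiv> emeasure (process_measure ell K Z \<omega>) B"

section \<open>Ordered pairs of distinct points\<close>

definition pairs :: "'w \<Rightarrow> (nat \<times> nat) set" where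
  "pairs \<omega> = {(i, j). i \<in> K \<omega> \<and> j \<in> K \<omega> \<and> i \<noteq> j}"

text \<open>The coordinates are grouped by point, not as \<open>(x, y, r, s)\<close>, so that
  rectangles are products of sets in \<open>XT\<close> and can be compared with products of
  counts.\<close>

definition pair_process :: "'w \<Rightarrow> (('x \<times> real) \<times> ('x \<times> real)) measure" where
  "pair_process \<omega> = dirac_sum (XT \<Otimes>\<^sub>M XT) (pairs \<omega>) (\<lambda>(i, j). (Z \<omega> i, Z \<omega> j))"

definition shift :: "real \<Rightarrow> 'x \<times> real \<Rightarrow> 'x \<times> real" where
  "shift t = (\<lambda>(x, s). (x, s + t))"

definition window :: "nat \<Rightarrow> ('x \<times> real) set" where
  "window m = UNIV \<times> ({- real m..real m} \<inter> space ell)"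

lemma space_XT: "space XT = UNIV \<times> space ell"
  by (simp add: space_pair_measure)

lemma shift_measurable [measurable]: "t \<in> space ell \<Longrightarrow> shift t \<in> XT \<rightarrow>\<^sub>M XT"
  unfolding shift_def by measurable

lemma window_sets [measurable, simp]: "window m \<in> sets XT"
  unfolding window_def by measurable

lemma incseq_window: "incseq window"
  by (auto simp: incseq_def window_def)

lemma UN_window: "(\<Union>m. window m) = space XT"
  unfolding window_def space_XT by (subst UN_centered_intervals[symmetric]) auto

text \<open>Here the boundedness of the mark space enters: sets over all marks and a bounded time
  interval become subject to the moment assumptions.\<close>

lemma bounded_strip: "bounded S \<Longrightarrow> bounded (UNIV \<times> S :: ('x \<times> real) set)"
  by (intro bounded_Times bounded_marks)

lemma bounded_Int_window: "bounded (A \<inter> window m)"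
proof (rule bounded_subset)
  show "bounded (UNIV \<times> {- real m..real m} :: ('x \<times> real) set)"
    by (rule bounded_strip) simp
qed (auto simp: window_def)

lemma bounded_window: "bounded (window m)"
  using bounded_Int_window[of "window m" m] by simp

lemma point_in_space: "\<omega> \<in> space P \<Longrightarrow> i \<in> K \<omega> \<Longrightarrow> Z \<omega> i \<in> space XT"
  using point_process by (auto simp: point_process_def)

lemma sets_process_measure [simp, measurable_cong]: "sets (process_measure ell K Z \<omega>) = sets XT"
  by (simp add: process_measure_def)

lemma N_measurable [measurable]: "B \<in> sets XT \<Longrightarrow> N B \<in> borel_measurable P"
  using point_process by (simp add: point_process_def)

lemma N_eq: "\<omega> \<in> space P \<Longrightarrow> B \<in> sets XT \<Longrightarrow>
    N B \<omega> = emeasure (count_space (K \<omega>)) {i \<in> K \<omega>. Z \<omega> i \<in> B}"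
  unfolding process_measure_def by (rule emeasure_dirac_sum) (simp_all add: point_in_space)

lemma finite_points:
  assumes "\<omega> \<in> space P" "bounded B"
  shows "finite {i \<in> K \<omega>. Z \<omega> i \<in> B}"
proof -
  have "bounded (snd ` B)"
    using assms(2) by (rule bounded_snd)
  then obtain a where "\<And>s. s \<in> snd ` B \<Longrightarrow> norm s \<le> a"
    by (auto simp: bounded_iff)
  then have "{i \<in> K \<omega>. Z \<omega> i \<in> B} \<subseteq> {i \<in> K \<omega>. snd (Z \<omega> i) \<in> {- a..a}}"
    by (fastforce simp: abs_le_iff)
  moreover have "finite {i \<in> K \<omega>. snd (Z \<omega> i) \<in> {- a..a}}"
    using point_process assms(1) by (simp add: point_process_def)
  ultimately show ?thesis
    by (rule finite_subset)
qed

lemma N_finite: "\<omega> \<in> space P \<Longrightarrow> B \<in> sets XT \<Longrightarrow> bounded B \<Longrightarrow> N B \<omega> < \<infinity>"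
  using finite_points by (auto simp: N_eq of_nat_less_top)

lemma
  assumes "A \<in> sets XT" "B \<in> sets XT" "bounded A" "bounded B"
  shows first_moment_shift: "t \<in> space ell \<Longrightarrow>
      (\<integral>\<^sup>+\<omega>. N (shift t -` A \<inter> space XT) \<omega> \<partial>P) = (\<integral>\<^sup>+\<omega>. N A \<omega> \<partial>P)"
    and first_moment_finite: "(\<integral>\<^sup>+\<omega>. N A \<omega> \<partial>P) < \<infinity>"
    and second_moment_shift: "t \<in> space ell \<Longrightarrow>
      (\<integral>\<^sup>+\<omega>. N (shift t -` A \<inter> space XT) \<omega> * N (shift t -` B \<inter> space XT) \<omega> \<partial>P)
        = (\<integral>\<^sup>+\<omega>. N A \<omega> * N B \<omega> \<partial>P)"
    and second_moment_finite: "(\<integral>\<^sup>+\<omega>. N A \<omega> * N B \<omega> \<partial>P) < \<infinity>"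
  \<comment> \<open>The finiteness clauses stand under the quantifier over shifts; the shift by 0
    releases them.\<close>
  using stationary assms zero_in_ell
  unfolding weakly_time_stationary_L2_def time_shift_vimage_def Let_def shift_def by blast+

lemma sets_pair_process [simp, measurable_cong]: "sets (pair_process \<omega>) = sets (XT \<Otimes>\<^sub>M XT)"
  by (simp add: pair_process_def)

lemma pair_process_eq:
  assumes "\<omega> \<in> space P" "C \<in> sets (XT \<Otimes>\<^sub>M XT)"
  shows "emeasure (pair_process \<omega>) C
    = emeasure (count_space (pairs \<omega>)) {(i, j) \<in> pairs \<omega>. (Z \<omega> i, Z \<omega> j) \<in> C}"
proof -
  have "(\<lambda>(i, j). (Z \<omega> i, Z \<omega> j)) p \<in> space (XT \<Otimes>\<^sub>M XT)" if "p \<in> pairs \<omega>" for p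
    using point_in_space[OF assms(1)] that
    unfolding pairs_def space_pair_measure[of XT XT] by auto
  then show ?thesis
    unfolding pair_process_def
    by (subst emeasure_dirac_sum[OF _ assms(2)]) (auto intro!: arg_cong2[where f = emeasure])
qed

text \<open>The pairs of indices of points in A and in B split into those with i, j distinct and the
  diagonal, which is a copy of the indices of points in the intersection. The diagonal term stays on
  the left to avoid subtraction in \<open>ennreal\<close>.\<close>

lemma pair_process_Times:
  assumes \<omega>: "\<omega> \<in> space P" and A: "A \<in> sets XT" "bounded A" and B: "B \<in> sets XT" "bounded B"
  shows "emeasure (pair_process \<omega>) (A \<times> B) + N (A \<inter> B) \<omega> = N A \<omega> * N B \<omega>"
proof -
  define I where "I C = {i \<in> K \<omega>. Z \<omega> i \<in> C}" for C
  have fin: "finite (I A)" "finite (I B)" "finite (I (A \<inter> B))"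
    unfolding I_def using A B bounded_subset[OF A(2), of "A \<inter> B"]
    by (auto intro!: finite_points[OF \<omega>] simp del: Int_iff)
  have N: "N C \<omega> = of_nat (card (I C))" if "C \<in> sets XT" "finite (I C)" for C
    using that N_eq[OF \<omega> that(1)] by (simp add: I_def emeasure_count_space)
  define D where "D = {(i, j) \<in> pairs \<omega>. (Z \<omega> i, Z \<omega> j) \<in> A \<times> B}"
  have split: "I A \<times> I B = D \<union> (\<lambda>i. (i, i)) ` I (A \<inter> B)" "D \<inter> (\<lambda>i. (i, i)) ` I (A \<inter> B) = {}"
    by (auto simp: I_def D_def pairs_def)
  have "finite D"
    using fin split(1) by (metis finite_SigmaI finite_Un)
  then have "card (I A \<times> I B) = card D + card ((\<lambda>i. (i, i)) ` I (A \<inter> B))"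
    unfolding split(1) using fin split(2) by (intro card_Un_disjoint) auto
  then have "card (I A) * card (I B) = card D + card (I (A \<inter> B))"
    by (simp add: card_cartesian_product card_image inj_on_def)
  moreover have "emeasure (pair_process \<omega>) (A \<times> B) = of_nat (card D)"
    using pair_process_eq[OF \<omega>, of "A \<times> B"] A B \<open>finite D\<close>
    by (simp add: D_def[symmetric]) (subst emeasure_count_space, auto simp: D_def)
  ultimately show ?thesis
    using fin A B by (simp add: N of_nat_mult[symmetric] of_nat_add[symmetric] del: of_nat_mult of_nat_add)
qed

lemma window_Times_sets [measurable, simp]: "window m \<times> window m \<in> sets (XT \<Otimes>\<^sub>M XT)"
  by simp

lemma incseq_window_Times: "incseq (\<lambda>m. window m \<times> window m)"
  using incseq_window by (auto simp: incseq_def)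

lemma UN_window_Times: "(\<Union>m. window m \<times> window m) = space (XT \<Otimes>\<^sub>M XT)"
proof -
  have "(p, q) \<in> (\<Union>m. window m \<times> window m)" if pq: "p \<in> space XT" "q \<in> space XT" for p q
  proof -
    obtain k l where "p \<in> window k" "q \<in> window l"
      using pq unfolding UN_window[symmetric] by auto
    then have "p \<in> window (max k l)" "q \<in> window (max k l)"
      using incseqD[OF incseq_window, of k "max k l"] incseqD[OF incseq_window, of l "max k l"] by auto
    then show ?thesis
      by auto
  qed
  moreover have "(\<Union>m. window m \<times> window m) \<subseteq> space XT \<times> space XT"
    using sets.sets_into_space[OF window_sets] by auto
  ultimately show ?thesis
    unfolding space_pair_measure[of XT XT] by (intro equalityI) auto
qed

lemma emeasure_SUP_window:
  assumes "sets M = sets XT" "A \<in> sets XT"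
  shows "emeasure M A = (SUP m. emeasure M (A \<inter> window m))"
proof -
  have "range (\<lambda>m. A \<inter> window m) \<subseteq> sets M" "incseq (\<lambda>m. A \<inter> window m)"
    using assms incseq_window by (auto simp: incseq_def)
  then have "(SUP m. emeasure M (A \<inter> window m)) = emeasure M (\<Union>m. A \<inter> window m)"
    by (rule SUP_emeasure_incseq)
  also have "(\<Union>m. A \<inter> window m) = A \<inter> (\<Union>m. window m)"
    by (rule Int_UN_distrib[symmetric])
  also have "\<dots> = A"
    unfolding UN_window using sets.sets_into_space[OF assms(2)] by (rule Int_absorb2)
  finally show ?thesis ..
qed

lemma emeasure_SUP_window_Times:
  assumes "sets M = sets (XT \<Otimes>\<^sub>M XT)" "C \<in> sets (XT \<Otimes>\<^sub>M XT)"
  shows "emeasure M C = (SUP m. emeasure M (C \<inter> (window m \<times> window m)))"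
proof -
  have "range (\<lambda>m. C \<inter> (window m \<times> window m)) \<subseteq> sets M"
    using sets.Int[OF assms(2) window_Times_sets] assms(1) by blast
  moreover have "incseq (\<lambda>m. C \<inter> (window m \<times> window m))"
    using incseq_window_Times unfolding incseq_def by blast
  ultimately have "(SUP m. emeasure M (C \<inter> (window m \<times> window m)))
      = emeasure M (\<Union>m. C \<inter> (window m \<times> window m))"
    by (rule SUP_emeasure_incseq)
  also have "(\<Union>m. C \<inter> (window m \<times> window m)) = C \<inter> (\<Union>m. window m \<times> window m)"
    by (rule Int_UN_distrib[symmetric])
  also have "\<dots> = C"
    unfolding UN_window_Times using sets.sets_into_space[OF assms(2)] by (rule Int_absorb2)
  finally show ?thesis ..
qed

text \<open>Only counts are known to be measurable, so the number of distinct pairs is expressed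
  through counts; the subtraction is legitimate because bounded sets contain finitely many
  points.\<close>

lemma pair_process_Times_measurable:
  assumes "A \<in> sets XT" "bounded A" "B \<in> sets XT" "bounded B"
  shows "(\<lambda>\<omega>. emeasure (pair_process \<omega>) (A \<times> B)) \<in> borel_measurable P"
proof -
  have "emeasure (pair_process \<omega>) (A \<times> B) = N A \<omega> * N B \<omega> - N (A \<inter> B) \<omega>" if "\<omega> \<in> space P" for \<omega>
  proof -
    have "N (A \<inter> B) \<omega> < \<infinity>"
      using that assms by (intro N_finite) (auto intro: bounded_subset)
    then show ?thesis
      unfolding pair_process_Times[OF that assms, symmetric] by (simp add: ennreal_add_diff_cancel_right)
  qed
  moreover have "(\<lambda>\<omega>. N A \<omega> * N B \<omega> - N (A \<inter> B) \<omega>) \<in> borel_measurable P"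
    using assms by measurable
  ultimately show ?thesis
    by (simp cong: measurable_cong)
qed

text \<open>A Dynkin argument starting from rectangles. The complement step subtracts from the total
  mass, which must be finite, so the argument runs inside a window square and is followed by a
  monotone limit.\<close>

lemma pair_process_measurable:
  assumes C: "C \<in> sets (XT \<Otimes>\<^sub>M XT)"
  shows "(\<lambda>\<omega>. emeasure (pair_process \<omega>) C) \<in> borel_measurable P"
proof -
  have "(\<lambda>\<omega>. emeasure (pair_process \<omega>) (C \<inter> (window m \<times> window m))) \<in> borel_measurable P" for m
  proof -
    let ?W = "window m \<times> window m"
    have fin: "emeasure (pair_process \<omega>) ?W < \<infinity>" if "\<omega> \<in> space P" for \<omega>
    proof -
      have "emeasure (pair_process \<omega>) ?W \<le> N (window m) \<omega> * N (window m) \<omega>"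
        unfolding pair_process_Times[OF that window_sets bounded_window window_sets bounded_window, symmetric]
        by simp
      also have "\<dots> < \<infinity>"
        using N_finite[OF that window_sets bounded_window] by (simp add: ennreal_mult_less_top)
      finally show ?thesis .
    qed
    have W: "(\<lambda>\<omega>. emeasure (pair_process \<omega>) ?W) \<in> borel_measurable P"
      by (intro pair_process_Times_measurable window_sets bounded_window)
    show ?thesis
      using Int_stable_pair_measure_generator[of XT XT] pair_measure_closed[of XT XT] C
      unfolding sets_pair_measure[of XT XT]
    proof (induction rule: sigma_sets_induct_disjoint)
      case (basic A)
      then obtain a b where "A = a \<times> b" "a \<in> sets XT" "b \<in> sets XT"
        by auto
      then show ?case
        using pair_process_Times_measurable[of "a \<inter> window m" "b \<inter> window m"] bounded_Int_window
        by (simp add: Times_Int_Times)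
    next
      case (compl A)
      then have A: "A \<in> sets (XT \<Otimes>\<^sub>M XT)"
        by (simp add: sets_pair_measure[of XT XT])
      have "emeasure (pair_process \<omega>) ((space XT \<times> space XT - A) \<inter> ?W)
          = emeasure (pair_process \<omega>) ?W - emeasure (pair_process \<omega>) (A \<inter> ?W)" if "\<omega> \<in> space P" for \<omega>
      proof -
        have "(space XT \<times> space XT - A) \<inter> ?W = ?W - A \<inter> ?W"
          using sets.sets_into_space[OF window_sets] by auto
        moreover have "emeasure (pair_process \<omega>) (A \<inter> ?W) \<noteq> \<infinity>"
          using fin[OF that] emeasure_mono[of "A \<inter> ?W" ?W "pair_process \<omega>"] by (auto simp: top_unique)
        ultimately show ?thesis
          using A by (simp add: emeasure_Diff)
      qed
      moreover have "(\<lambda>\<omega>. emeasure (pair_process \<omega>) ?W - emeasure (pair_process \<omega>) (A \<inter> ?W)) \<in> borel_measurable P"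
        using W compl by measurable
      ultimately show ?case
        by (simp cong: measurable_cong)
    next
      case (union A)
      then have A: "range A \<subseteq> sets (XT \<Otimes>\<^sub>M XT)"
        by (simp add: sets_pair_measure[of XT XT])
      have "emeasure (pair_process \<omega>) ((\<Union>i. A i) \<inter> ?W) = (\<Sum>i. emeasure (pair_process \<omega>) (A i \<inter> ?W))" for \<omega>
      proof -
        have "disjoint_family (\<lambda>i. A i \<inter> ?W)"
          using union(1) by (auto simp: disjoint_family_on_def)
        moreover have "range (\<lambda>i. A i \<inter> ?W) \<subseteq> sets (pair_process \<omega>)"
          using A by auto
        ultimately show ?thesis
          by (simp add: suminf_emeasure)
      qed
      then show ?case
        using union(3) by simp
    qed simp
  qed
  then show ?thesis
    unfolding emeasure_SUP_window_Times[OF sets_pair_process C] by simp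
qed

section \<open>The second factorial moment on bounded rectangles\<close>

definition pair_moment :: "(('x \<times> real) \<times> ('x \<times> real)) measure" where
  "pair_moment = mean_measure P (XT \<Otimes>\<^sub>M XT) pair_process"

lemma sets_pair_moment [simp, measurable_cong]: "sets pair_moment = sets (XT \<Otimes>\<^sub>M XT)"
  and space_pair_moment: "space pair_moment = space (XT \<Otimes>\<^sub>M XT)"
  by (simp_all add: pair_moment_def)

lemma emeasure_pair_moment: "C \<in> sets (XT \<Otimes>\<^sub>M XT) \<Longrightarrow>
    emeasure pair_moment C = (\<integral>\<^sup>+\<omega>. emeasure (pair_process \<omega>) C \<partial>P)"
  unfolding pair_moment_def by (intro emeasure_mean_measure pair_process_measurable) simp_all

lemma pair_moment_Times:
  assumes "A \<in> sets XT" "bounded A" "B \<in> sets XT" "bounded B"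
  shows "emeasure pair_moment (A \<times> B) + (\<integral>\<^sup>+\<omega>. N (A \<inter> B) \<omega> \<partial>P) = (\<integral>\<^sup>+\<omega>. N A \<omega> * N B \<omega> \<partial>P)"
proof -
  have "emeasure pair_moment (A \<times> B) + (\<integral>\<^sup>+\<omega>. N (A \<inter> B) \<omega> \<partial>P)
      = (\<integral>\<^sup>+\<omega>. emeasure (pair_process \<omega>) (A \<times> B) + N (A \<inter> B) \<omega> \<partial>P)"
    using assms by (simp add: emeasure_pair_moment nn_integral_add pair_process_measurable)
  also have "\<dots> = (\<integral>\<^sup>+\<omega>. N A \<omega> * N B \<omega> \<partial>P)"
    using assms by (intro nn_integral_cong pair_process_Times)
  finally show ?thesis .
qed

lemma pair_moment_Times_le:
  assumes "A \<in> sets XT" "bounded A" "B \<in> sets XT" "bounded B"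
  shows "emeasure pair_moment (A \<times> B) \<le> (\<integral>\<^sup>+\<omega>. N A \<omega> * N B \<omega> \<partial>P)"
  unfolding pair_moment_Times[OF assms, symmetric] by simp

lemma pair_moment_Times_finite:
  assumes "A \<in> sets XT" "bounded A" "B \<in> sets XT" "bounded B"
  shows "emeasure pair_moment (A \<times> B) < \<infinity>"
  using pair_moment_Times_le[OF assms] second_moment_finite[of A B] assms by (auto intro: le_less_trans)

lemma shift_vimage_bounded:
  assumes "bounded A"
  shows "bounded (shift t -` A \<inter> space XT)"
proof -
  have "bounded (UNIV \<times> (\<lambda>s. s - t) ` snd ` A :: ('x \<times> real) set)"
    using assms by (intro bounded_strip bounded_translation_minus bounded_snd)
  moreover have "shift t -` A \<subseteq> UNIV \<times> (\<lambda>s. s - t) ` snd ` A"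
    by (force simp: shift_def)
  ultimately show ?thesis
    by (blast intro: bounded_subset)
qed

section \<open>Shift invariance of the moment measures\<close>

definition first_moment :: "('x \<times> real) measure" where
  "first_moment = first_moment_measure P ell K Z"

lemma sets_first_moment [simp, measurable_cong]: "sets first_moment = sets XT"
  by (simp add: first_moment_def first_moment_measure_def)

lemma emeasure_first_moment: "A \<in> sets XT \<Longrightarrow> emeasure first_moment A = (\<integral>\<^sup>+\<omega>. N A \<omega> \<partial>P)"
  unfolding first_moment_def first_moment_measure_def
  by (intro emeasure_mean_measure) simp_all

text \<open>Stationarity is assumed for bounded sets only; it is applied to the traces on windows,
  and continuity from below gives all measurable sets.\<close>

lemma first_moment_shift_invariant:
  assumes t: "t \<in> space ell"
  shows "distr first_moment XT (shift t) = first_moment"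
proof (rule measure_eqI)
  have [measurable]: "t \<in> space ell" by fact
  fix A assume "A \<in> sets (distr first_moment XT (shift t))"
  then have A [measurable]: "A \<in> sets XT"
    by simp
  have "emeasure (distr first_moment XT (shift t)) (A \<inter> window m) = emeasure first_moment (A \<inter> window m)" for m
  proof -
    have B [measurable]: "A \<inter> window m \<in> sets XT"
      by simp
    have "emeasure (distr first_moment XT (shift t)) (A \<inter> window m)
        = (\<integral>\<^sup>+\<omega>. N (shift t -` (A \<inter> window m) \<inter> space XT) \<omega> \<partial>P)"
      using measurable_sets[OF shift_measurable[OF t] B]
      by (subst emeasure_distr) (simp_all add: emeasure_first_moment sets_eq_imp_space_eq[OF sets_first_moment])
    also have "\<dots> = emeasure first_moment (A \<inter> window m)"
      using first_moment_shift[OF B B bounded_Int_window bounded_Int_window t]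
      by (simp add: emeasure_first_moment)
    finally show ?thesis .
  qed
  then show "emeasure (distr first_moment XT (shift t)) A = emeasure first_moment A"
    using emeasure_SUP_window[OF _ A, of "distr first_moment XT (shift t)"]
      emeasure_SUP_window[OF _ A, of first_moment] by simp
qed simp

definition shift2 :: "real \<Rightarrow> ('x \<times> real) \<times> ('x \<times> real) \<Rightarrow> ('x \<times> real) \<times> ('x \<times> real)" where
  "shift2 t = (\<lambda>(p, q). (shift t p, shift t q))"

lemma shift2_measurable [measurable]: "t \<in> space ell \<Longrightarrow> shift2 t \<in> XT \<Otimes>\<^sub>M XT \<rightarrow>\<^sub>M XT \<Otimes>\<^sub>M XT"
  unfolding shift2_def by measurable

text \<open>The assumed invariance concerns E(\<Xi>(A) \<Xi>(B)), diagonal included. The diagonal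
  contributes the first moment of the intersection, which is itself invariant and finite, so it
  cancels.\<close>

lemma pair_moment_shift_bounded:
  assumes t: "t \<in> space ell" and A: "A \<in> sets XT" "bounded A" and B: "B \<in> sets XT" "bounded B"
  shows "emeasure pair_moment ((shift t -` A \<inter> space XT) \<times> (shift t -` B \<inter> space XT))
    = emeasure pair_moment (A \<times> B)"
proof -
  let ?V = "\<lambda>C. shift t -` C \<inter> space XT"
  have V: "?V C \<in> sets XT" if "C \<in> sets XT" for C
    using measurable_sets[OF shift_measurable[OF t] that] .
  have AB: "A \<inter> B \<in> sets XT" "bounded (A \<inter> B)"
    using A B by (auto intro: bounded_subset)
  have "emeasure pair_moment (?V A \<times> ?V B) + (\<integral>\<^sup>+\<omega>. N (A \<inter> B) \<omega> \<partial>P)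
      = emeasure pair_moment (?V A \<times> ?V B) + (\<integral>\<^sup>+\<omega>. N (?V A \<inter> ?V B) \<omega> \<partial>P)"
    using first_moment_shift[OF AB(1) AB(1) AB(2) AB(2) t] by (simp add: vimage_Int Int_ac)
  also have "\<dots> = (\<integral>\<^sup>+\<omega>. N (?V A) \<omega> * N (?V B) \<omega> \<partial>P)"
    using A B by (intro pair_moment_Times V shift_vimage_bounded)
  also have "\<dots> = (\<integral>\<^sup>+\<omega>. N A \<omega> * N B \<omega> \<partial>P)"
    using A B t by (intro second_moment_shift)
  also have "\<dots> = emeasure pair_moment (A \<times> B) + (\<integral>\<^sup>+\<omega>. N (A \<inter> B) \<omega> \<partial>P)"
    using pair_moment_Times[OF A B] ..
  finally show ?thesis
    using first_moment_finite[OF AB(1) AB(1) AB(2) AB(2)] 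
    by (auto simp: add.commute[of _ "integral\<^sup>N _ _"] ennreal_add_left_cancel)
qed

text \<open>Rectangles form an intersection-stable generator and window squares have finite mass.
  The generator contains unbounded rectangles too; these are reached from bounded ones by the
  windows.\<close>

lemma pair_moment_shift_invariant:
  assumes t: "t \<in> space ell"
  shows "distr pair_moment (XT \<Otimes>\<^sub>M XT) (shift2 t) = pair_moment" (is "?D = _")
proof -
  have [measurable]: "t \<in> space ell" by fact
  let ?G = "{a \<times> b |a b. a \<in> sets XT \<and> b \<in> sets XT}"
  have bounded: "emeasure ?D (A \<times> B) = emeasure pair_moment (A \<times> B)"
    if A: "A \<in> sets XT" "bounded A" and B: "B \<in> sets XT" "bounded B" for A B
  proof -
    have "shift2 t -` (A \<times> B) \<inter> space (XT \<Otimes>\<^sub>M XT) = (shift t -` A \<inter> space XT) \<times> (shift t -` B \<inter> space XT)"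
      unfolding space_pair_measure[of XT XT] by (auto simp: shift2_def)
    then show ?thesis
      using A B pair_moment_shift_bounded[OF t A B] by (subst emeasure_distr) (simp_all add: space_pair_moment)
  qed
  have win: "emeasure ?D (window m \<times> window m) \<noteq> \<infinity>" for m
    using bounded[OF window_sets bounded_window window_sets bounded_window, of m m]
      pair_moment_Times_finite[OF window_sets bounded_window window_sets bounded_window, of m m]
    by (simp add: less_top)
  show ?thesis
  proof (rule measure_eqI_generator_eq[where E = ?G and \<Omega> = "space XT \<times> space XT" and A = "\<lambda>m. window m \<times> window m"])
    fix X assume "X \<in> ?G"
    then obtain A B where X: "X = A \<times> B" and A: "A \<in> sets XT" and B: "B \<in> sets XT"
      by auto
    have "emeasure ?D (X \<inter> (window m \<times> window m)) = emeasure pair_moment (X \<inter> (window m \<times> window m))" for m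
      using bounded[of "A \<inter> window m" "B \<inter> window m"] A B bounded_Int_window
      by (simp add: X Times_Int_Times)
    moreover have "X \<in> sets (XT \<Otimes>\<^sub>M XT)"
      using A B by (simp add: X)
    ultimately show "emeasure ?D X = emeasure pair_moment X"
      using emeasure_SUP_window_Times[of ?D X] emeasure_SUP_window_Times[of pair_moment X] by simp
  next
    show "(\<Union>m. window m \<times> window m) = space XT \<times> space XT"
      unfolding UN_window_Times space_pair_measure[of XT XT] ..
    show "range (\<lambda>m. window m \<times> window m) \<subseteq> ?G"
      using window_sets by blast
  qed (use win in \<open>simp_all add: Int_stable_pair_measure_generator pair_measure_closed sets_pair_measure[of XT XT]\<close>)
qed

section \<open>The mark intensity\<close>

definition \<mu> :: "'x measure" where
  "\<mu> = mark_intensity P ell K Z"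

text \<open>A time set of mass 1: evaluating a product measure on a box with time side
  \<open>V\<close> returns its other factor, which gives uniqueness in both disintegrations.\<close>

definition V :: "real set" where
  "V = {-1..<0} \<inter> space ell"

lemma V_sets [measurable, simp]: "V \<in> sets ell"
  and emeasure_V [simp]: "emeasure ell V = 1"
  by (simp_all add: V_def emeasure_ell_unit)

text \<open>The coordinates are swapped to put time first, as the disintegration requires, and
  swapped back afterwards. Uniqueness follows by testing on boxes with time side
  \<open>V\<close>.\<close>

lemma mark_intensity: "sets \<mu> = sets borel" "finite_measure \<mu>"
proof -
  let ?\<nu> = "distr first_moment (ell \<Otimes>\<^sub>M borel) (\<lambda>(x, s). (s, x))"
  have swap: "distr ?\<nu> (ell \<Otimes>\<^sub>M borel) (\<lambda>(r, c). (r + t, c)) = ?\<nu>" if [measurable]: "t \<in> space ell" for t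
  proof -
    have "distr ?\<nu> (ell \<Otimes>\<^sub>M borel) (\<lambda>(r, c). (r + t, c))
        = distr (distr first_moment XT (shift t)) (ell \<Otimes>\<^sub>M borel) (\<lambda>(x, s). (s, x))"
      by (subst (1 2) distr_distr) (auto intro!: distr_cong simp: shift_def)
    then show ?thesis
      by (simp add: first_moment_shift_invariant[OF that])
  qed
  have \<nu>_strip: "emeasure ?\<nu> (S \<times> UNIV) < \<infinity>" if S: "S \<in> sets ell" "bounded S" for S
  proof -
    have "(\<lambda>(x, s). (s, x)) -` (S \<times> UNIV) \<inter> space XT = (UNIV :: 'x set) \<times> S"
      using sets.sets_into_space[OF S(1)] by (auto simp: space_XT)
    then have "emeasure ?\<nu> (S \<times> UNIV) = emeasure first_moment (UNIV \<times> S)"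
      using S by (subst emeasure_distr) (simp_all add: sets_eq_imp_space_eq[OF sets_first_moment])
    also have "\<dots> < \<infinity>"
      using S first_moment_finite[of "UNIV \<times> S" "UNIV \<times> S"] bounded_strip[OF S(2)]
      by (simp add: emeasure_first_moment)
    finally show ?thesis .
  qed
  have fin: "emeasure ?\<nu> (({- real m..real m} \<inter> space ell) \<times> UNIV) < \<infinity>" for m
    by (intro \<nu>_strip bounded_Int) simp_all
  obtain \<mu>' where \<mu>': "sets \<mu>' = sets borel" "sigma_finite_measure \<mu>'" "?\<nu> = ell \<Otimes>\<^sub>M \<mu>'"
    "\<And>C. C \<in> sets borel \<Longrightarrow> emeasure \<mu>' C = emeasure ?\<nu> (({0<..1} \<inter> space ell) \<times> C)"
    \<comment> \<open>The constant sequence suffices as exhaustion: a bounded time interval with all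
      marks already has finite mass.\<close>
    by (rule shift_invariant_disintegration[of ?\<nu> borel "\<lambda>_. UNIV", OF _ swap _ _ fin]) auto
  interpret \<mu>': finite_measure \<mu>'
    using \<nu>_strip[of "{0<..1} \<inter> space ell"] \<mu>'(4)[of UNIV] sets_eq_imp_space_eq[OF \<mu>'(1)]
    by (intro finite_measureI) (auto simp: bounded_Int)
  interpret pair_sigma_finite \<mu>' ell ..
  have "first_moment = distr ?\<nu> XT (\<lambda>(s, x). (x, s))"
    by (subst distr_distr) (auto simp: comp_def split_beta' distr_id2)
  also have "\<dots> = distr (ell \<Otimes>\<^sub>M \<mu>') (\<mu>' \<Otimes>\<^sub>M ell) (\<lambda>(s, x). (x, s))"
    unfolding \<mu>'(3) using \<mu>'(1) by (intro distr_cong sets_pair_measure_cong) auto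
  also have "\<dots> = \<mu>' \<Otimes>\<^sub>M ell"
    by (rule distr_pair_swap[symmetric])
  finally have eq: "first_moment = \<mu>' \<Otimes>\<^sub>M ell" .
  have "\<mu> = \<mu>'"
    unfolding \<mu>_def mark_intensity_def
  proof (rule the_equality)
    show "sets \<mu>' = sets borel \<and> finite_measure \<mu>' \<and> first_moment_measure P ell K Z = \<mu>' \<Otimes>\<^sub>M ell"
      using eq \<mu>'(1) \<mu>'.finite_measure_axioms by (simp add: first_moment_def)
  next
    fix \<mu>'' :: "'x measure"
    assume *: "sets \<mu>'' = sets borel \<and> finite_measure \<mu>'' \<and> first_moment_measure P ell K Z = \<mu>'' \<Otimes>\<^sub>M ell"
    show "\<mu>'' = \<mu>'"
    proof (rule measure_eqI)
      fix A assume A: "A \<in> sets \<mu>''"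
      have "emeasure \<mu>'' A * emeasure ell V = emeasure first_moment (A \<times> V)"
        using A * ell.emeasure_pair_measure_Times[of A \<mu>'' V] by (simp add: first_moment_def)
      also have "\<dots> = emeasure \<mu>' A * emeasure ell V"
        unfolding eq using A * \<mu>'(1) by (intro ell.emeasure_pair_measure_Times) auto
      finally show "emeasure \<mu>'' A = emeasure \<mu>' A"
        by simp
    qed (use * \<mu>'(1) in simp)
  qed
  then show "sets \<mu> = sets borel" "finite_measure \<mu>"
    using \<mu>'(1) \<mu>'.finite_measure_axioms by simp_all
qed

section \<open>The reduced factorial moment measure\<close>

abbreviation S3 :: "('x \<times> 'x \<times> real) measure" where
  "S3 \<equiv> borel \<Otimes>\<^sub>M borel \<Otimes>\<^sub>M ell"

abbreviation S4 :: "('x \<times> 'x \<times> real \<times> real) measure" where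
  "S4 \<equiv> borel \<Otimes>\<^sub>M borel \<Otimes>\<^sub>M ell \<Otimes>\<^sub>M ell"

lemma space_S3: "space S3 = UNIV \<times> UNIV \<times> space ell"
  by (simp add: space_pair_measure)

lemma space_S4: "space S4 = UNIV \<times> UNIV \<times> space ell \<times> space ell"
  by (simp add: space_pair_measure)

definition flatten :: "('x \<times> real) \<times> ('x \<times> real) \<Rightarrow> 'x \<times> 'x \<times> real \<times> real" where
  "flatten = (\<lambda>((x, r), (y, s)). (x, y, r, s))"

lemma flatten_measurable [measurable]: "flatten \<in> XT \<Otimes>\<^sub>M XT \<rightarrow>\<^sub>M S4"
  unfolding flatten_def split_beta' by measurable

text \<open>Both sides count the same index pairs, so the process of quadruples inherits its
  measurability from \<open>pair_process\<close>; this is needed before the mean measure of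
  quadruples can be evaluated at all.\<close>

lemma factorial_moment_measure_eq:
  "factorial_moment_measure P ell K Z = distr pair_moment S4 flatten"
proof (rule measure_eqI)
  note f = flatten_measurable
  let ?R = "\<lambda>\<omega>. dirac_sum S4 (pairs \<omega>) (\<lambda>(i, j). (fst (Z \<omega> i), fst (Z \<omega> j), snd (Z \<omega> i), snd (Z \<omega> j)))"
  have R: "emeasure (?R \<omega>) B = emeasure (pair_process \<omega>) (flatten -` B \<inter> space (XT \<Otimes>\<^sub>M XT))"
    if \<omega>: "\<omega> \<in> space P" and B: "B \<in> sets S4" for \<omega> B
  proof -
    have Z: "(Z \<omega> i, Z \<omega> j) \<in> space (XT \<Otimes>\<^sub>M XT)" if "(i, j) \<in> pairs \<omega>" for i j
      using that point_in_space[OF \<omega>] unfolding space_pair_measure[of XT XT] by (auto simp: pairs_def)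
    have "emeasure (?R \<omega>) B = emeasure (count_space (pairs \<omega>))
        {p \<in> pairs \<omega>. (\<lambda>(i, j). (fst (Z \<omega> i), fst (Z \<omega> j), snd (Z \<omega> i), snd (Z \<omega> j))) p \<in> B}"
      using B point_in_space[OF \<omega>]
      by (intro emeasure_dirac_sum) (auto simp: pairs_def space_S4 space_XT mem_Times_iff)
    also have "\<dots> = emeasure (pair_process \<omega>) (flatten -` B \<inter> space (XT \<Otimes>\<^sub>M XT))"
      using Z
      by (subst pair_process_eq[OF \<omega> measurable_sets[OF f B]])
        (auto intro!: arg_cong2[where f = emeasure] simp: flatten_def split_beta')
    finally show ?thesis .
  qed
  have R_meas: "(\<lambda>\<omega>. emeasure (?R \<omega>) B) \<in> borel_measurable P" if "B \<in> sets S4" for B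
    using pair_process_measurable[OF measurable_sets[OF f that]] R[OF _ that]
    by (simp cong: measurable_cong)
  fix B assume "B \<in> sets (factorial_moment_measure P ell K Z)"
  then have B: "B \<in> sets S4"
    by (simp add: factorial_moment_measure_def)
  have "emeasure (factorial_moment_measure P ell K Z) B = (\<integral>\<^sup>+\<omega>. emeasure (?R \<omega>) B \<partial>P)"
    unfolding factorial_moment_measure_def pairs_def[symmetric]
    by (rule emeasure_mean_measure[OF _ R_meas B]) simp
  also have "\<dots> = (\<integral>\<^sup>+\<omega>. emeasure (pair_process \<omega>) (flatten -` B \<inter> space (XT \<Otimes>\<^sub>M XT)) \<partial>P)"
    using R[OF _ B] by (intro nn_integral_cong)
  also have "\<dots> = emeasure (distr pair_moment S4 flatten) B"
    using f B measurable_sets[OF f B]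
    by (subst emeasure_distr) (simp_all add: emeasure_pair_moment space_pair_moment)
  finally show "emeasure (factorial_moment_measure P ell K Z) B = emeasure (distr pair_moment S4 flatten) B" .
qed (simp add: factorial_moment_measure_def)

definition slab :: "nat \<Rightarrow> ('x \<times> 'x \<times> real) set" where
  "slab n = UNIV \<times> UNIV \<times> ({- real n..real n} \<inter> space ell)"

lemma slab_sets [measurable, simp]: "slab n \<in> sets S3"
  unfolding slab_def by measurable

lemma incseq_slab: "incseq slab"
  by (auto simp: incseq_def slab_def)

lemma UN_slab: "(\<Union>n. slab n) = space S3"
  unfolding slab_def space_S3 by (subst UN_centered_intervals[symmetric]) auto

lemma bounded_slab: "bounded (slab n)"
  unfolding slab_def by (intro bounded_Times bounded_marks bounded_Int) simp

lemma subset_slab: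
  assumes "C \<in> sets S3" "bounded ((\<lambda>(x, y, s). s) ` C)"
  obtains n where "C \<subseteq> slab n"
proof -
  obtain a where a: "\<And>s. s \<in> (\<lambda>(x, y, s). s) ` C \<Longrightarrow> norm s \<le> a"
    using assms(2) by (auto simp: bounded_iff)
  obtain n :: nat where "a \<le> real n"
    using real_arch_simple by blast
  then have "C \<subseteq> slab n"
    using a sets.sets_into_space[OF assms(1)] by (fastforce simp: slab_def space_S3 abs_le_iff)
  then show thesis
    by (rule that)
qed

text \<open>The map \<psi> of the reduction, with the first time moved to the front. A common time
  shift of both points changes only this front coordinate and leaves the lag alone, which is the
  form of invariance that the disintegration handles.\<close>

definition lag_map :: "('x \<times> real) \<times> ('x \<times> real) \<Rightarrow> real \<times> ('x \<times> 'x \<times> real)" where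
  "lag_map = (\<lambda>((x, r), (y, s)). (r, (x, y, s - r)))"

lemma lag_map_measurable [measurable]: "lag_map \<in> XT \<Otimes>\<^sub>M XT \<rightarrow>\<^sub>M ell \<Otimes>\<^sub>M S3"
  unfolding lag_map_def split_beta' by measurable

definition M2 :: "('x \<times> 'x \<times> real) measure" where
  "M2 = reduced_factorial_moment_measure P ell K Z"

definition reorder :: "real \<times> ('x \<times> 'x \<times> real) \<Rightarrow> 'x \<times> 'x \<times> real \<times> real" where
  "reorder = (\<lambda>(r, x, y, s). (x, y, r, s))"

lemma reorder_measurable [measurable]: "reorder \<in> ell \<Otimes>\<^sub>M S3 \<rightarrow>\<^sub>M S4"
  unfolding reorder_def by measurable

text \<open>The last part makes the definite description concrete: \<open>M2\<close> of C is the
  expected number of ordered pairs whose first point has time in (0,1] and whose marks and lag lie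
  in C. The growth estimate rests on this formula.\<close>

lemma reduced_factorial_moment_measure:
  shows "sets M2 = sets S3" "\<And>C. C \<in> sets S3 \<Longrightarrow> bounded C \<Longrightarrow> emeasure M2 C < \<infinity>"
    and "\<And>C. C \<in> sets S3 \<Longrightarrow>
      emeasure M2 C = emeasure pair_moment (lag_map -` (({0<..1} \<inter> space ell) \<times> C) \<inter> space (XT \<Otimes>\<^sub>M XT))"
proof -
  let ?\<nu> = "distr pair_moment (ell \<Otimes>\<^sub>M S3) lag_map"
  have inv: "distr ?\<nu> (ell \<Otimes>\<^sub>M S3) (\<lambda>(r, c). (r + t, c)) = ?\<nu>" if [measurable]: "t \<in> space ell" for t
  proof -
    have "distr ?\<nu> (ell \<Otimes>\<^sub>M S3) (\<lambda>(r, c). (r + t, c))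
        = distr (distr pair_moment (XT \<Otimes>\<^sub>M XT) (shift2 t)) (ell \<Otimes>\<^sub>M S3) lag_map"
      by (subst (1 2) distr_distr) (simp_all, auto intro!: distr_cong simp: shift_def shift2_def lag_map_def)
    then show ?thesis
      by (simp add: pair_moment_shift_invariant[OF that])
  qed
  have fin: "emeasure ?\<nu> (({- real m..real m} \<inter> space ell) \<times> slab n) < \<infinity>" for m n
  proof -
    \<comment> \<open>A first time of modulus at most \<open>m\<close> and a lag of modulus at most
      \<open>n\<close> give a second time of modulus at most \<open>m + n\<close>.\<close>
    have "lag_map -` (({- real m..real m} \<inter> space ell) \<times> slab n) \<inter> space (XT \<Otimes>\<^sub>M XT)
        \<subseteq> window m \<times> window (m + n)"
      unfolding space_pair_measure[of XT XT] by (auto simp: lag_map_def slab_def window_def space_XT)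
    then have "emeasure ?\<nu> (({- real m..real m} \<inter> space ell) \<times> slab n) \<le> emeasure pair_moment (window m \<times> window (m + n))"
      by (subst emeasure_distr) (auto simp: space_pair_moment intro!: emeasure_mono)
    also have "\<dots> < \<infinity>"
      by (intro pair_moment_Times_finite window_sets bounded_window)
    finally show ?thesis .
  qed
  obtain M where M: "sets M = sets S3" "sigma_finite_measure M" "?\<nu> = ell \<Otimes>\<^sub>M M"
    "\<And>C. C \<in> sets S3 \<Longrightarrow> emeasure M C = emeasure ?\<nu> (({0<..1} \<inter> space ell) \<times> C)"
    by (rule shift_invariant_disintegration[of ?\<nu> S3 slab, OF _ inv _ UN_slab fin]) auto
  have M_fin: "emeasure M C < \<infinity>" if C: "C \<in> sets S3" "bounded C" for C
  proof -
    have "bounded ((\<lambda>(x, y, s). s) ` C)"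
      using bounded_snd[OF bounded_snd[OF C(2)]] by (simp add: image_image split_beta')
    then obtain n where "C \<subseteq> slab n"
      by (rule subset_slab[OF C(1)])
    then have "emeasure M C \<le> emeasure ?\<nu> (({- real 1..real 1} \<inter> space ell) \<times> slab n)"
      unfolding M(4)[OF C(1)] by (intro emeasure_mono) auto
    then show ?thesis
      using fin[of 1 n] by (rule le_less_trans)
  qed
  have char: "distr (factorial_moment_measure P ell K Z) S4 (\<lambda>(x, y, r, s). (x, y, r, s - r))
      = distr (ell \<Otimes>\<^sub>M M) S4 reorder"
    unfolding M(3)[symmetric] factorial_moment_measure_eq
    by (subst (1 2) distr_distr) (simp_all, auto intro!: distr_cong simp: lag_map_def reorder_def flatten_def)
  \<comment> \<open>The image measure determines the factor: the displayed set pulls back along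
    \<open>reorder\<close> to \<open>V \<times> C\<close>, and \<open>V\<close> has mass 1. Hence
    two candidates with the same image agree.\<close>
  have box: "emeasure (distr (ell \<Otimes>\<^sub>M M') S4 reorder) ((\<lambda>(x, y, r, s). (r, x, y, s)) -` (V \<times> C) \<inter> space S4) = emeasure M' C"
    if sets: "sets M' = sets S3" and "sigma_finite_measure M'" and C: "C \<in> sets S3" for M' C
  proof -
    interpret M': sigma_finite_measure M' by fact
    note [measurable_cong] = sets
    have inv_reorder: "(\<lambda>(x, y, r, s). (r, x, y, s)) \<in> S4 \<rightarrow>\<^sub>M ell \<Otimes>\<^sub>M S3"
      by measurable
    have "reorder -` ((\<lambda>(x, y, r, s). (r, x, y, s)) -` (V \<times> C) \<inter> space S4) \<inter> space (ell \<Otimes>\<^sub>M M') = V \<times> C"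
      using sets.sets_into_space[OF C] sets.sets_into_space[OF V_sets] sets_eq_imp_space_eq[OF sets]
      unfolding space_S4 space_pair_measure[of ell M'] space_S3 reorder_def by auto
    moreover have "(\<lambda>(x, y, r, s). (r, x, y, s)) -` (V \<times> C) \<inter> space S4 \<in> sets S4"
      using C by (intro measurable_sets[OF inv_reorder]) auto
    ultimately have "emeasure (distr (ell \<Otimes>\<^sub>M M') S4 reorder) ((\<lambda>(x, y, r, s). (r, x, y, s)) -` (V \<times> C) \<inter> space S4)
        = emeasure (ell \<Otimes>\<^sub>M M') (V \<times> C)"
      by (subst emeasure_distr) auto
    also have "\<dots> = emeasure M' C"
      using C sets by (subst M'.emeasure_pair_measure_Times) auto
    finally show ?thesis .
  qed
  have "M2 = M"
    unfolding M2_def reduced_factorial_moment_measure_def reorder_def[symmetric]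
  proof (rule the_equality)
    show "sets M = sets S3 \<and> (\<forall>C\<in>sets M. bounded C \<longrightarrow> emeasure M C < \<infinity>) \<and>
        distr (factorial_moment_measure P ell K Z) S4 (\<lambda>(x, y, r, s). (x, y, r, s - r)) = distr (ell \<Otimes>\<^sub>M M) S4 reorder"
      using M(1) M_fin char by simp
  next
    fix M' :: "('x \<times> 'x \<times> real) measure"
    assume *: "sets M' = sets S3 \<and> (\<forall>C\<in>sets M'. bounded C \<longrightarrow> emeasure M' C < \<infinity>) \<and>
        distr (factorial_moment_measure P ell K Z) S4 (\<lambda>(x, y, r, s). (x, y, r, s - r)) = distr (ell \<Otimes>\<^sub>M M') S4 reorder"
    \<comment> \<open>Local finiteness of a competitor gives finite mass on the slabs, hence the
      sigma-finiteness that evaluating the product on boxes requires.\<close>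
    have "sigma_finite_measure M'"
    proof
      have "emeasure M' (slab n) \<noteq> \<infinity>" for n
        using * bounded_slab[of n] slab_sets[of n] by (auto simp: less_top)
      then show "\<exists>A. countable A \<and> A \<subseteq> sets M' \<and> \<Union>A = space M' \<and> (\<forall>a\<in>A. emeasure M' a \<noteq> \<infinity>)"
        using * sets_eq_imp_space_eq[of M' S3] by (intro exI[of _ "range slab"]) (auto simp: UN_slab)
    qed
    then show "M' = M"
      using * box[of M'] box[OF M(1,2)] char by (intro measure_eqI) (simp_all add: M(1))
  qed
  then show "sets M2 = sets S3" "\<And>C. C \<in> sets S3 \<Longrightarrow> bounded C \<Longrightarrow> emeasure M2 C < \<infinity>"
    "\<And>C. C \<in> sets S3 \<Longrightarrow>
      emeasure M2 C = emeasure pair_moment (lag_map -` (({0<..1} \<inter> space ell) \<times> C) \<inter> space (XT \<Otimes>\<^sub>M XT))"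
    using M(1,4) M_fin by (simp_all add: emeasure_distr space_pair_moment)
qed

end

subsection \<open>Growth of second moments\<close>

text \<open>The product is at most the square of the larger factor; no subtraction occurs, so
  infinite values cause no trouble.\<close>

lemma ennreal_mult_le_sum_squares: "a * b \<le> a * a + b * (b :: ennreal)"
proof (cases "a \<le> b")
  case True
  then have "a * b \<le> b * b"
    by (intro mult_right_mono) auto
  then show ?thesis
    by (simp add: add_increasing)
next
  case False
  then have "a * b \<le> a * a"
    by (intro mult_left_mono) auto
  then show ?thesis
    by (simp add: add_increasing2)
qed

lemma sum_squares_le_square_sum:
  fixes f :: "'i \<Rightarrow> ennreal"
  assumes "finite I"
  shows "(\<Sum>i\<in>I. f i * f i) \<le> (\<Sum>i\<in>I. f i) * (\<Sum>i\<in>I. f i)"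
  unfolding sum_distrib_right
  using assms by (intro sum_mono mult_left_mono member_le_sum) auto

context stationary_process
begin

definition strip :: "nat \<Rightarrow> ('x \<times> real) set" where
  "strip k = UNIV \<times> ({real k<..real k + 2} \<inter> space ell)"

definition strip_moment :: ennreal where
  "strip_moment = (\<integral>\<^sup>+\<omega>. N (strip 0) \<omega> * N (strip 0) \<omega> \<partial>P)"

lemma strip_sets [measurable, simp]: "strip k \<in> sets XT"
  unfolding strip_def by measurable

lemma bounded_strip_nat: "bounded (strip k)"
  unfolding strip_def by (intro bounded_strip bounded_Int) simp

lemma strip_moment_finite: "strip_moment < \<infinity>"
  unfolding strip_moment_def
  by (intro second_moment_finite strip_sets bounded_strip_nat)

lemma strip_moment_le: "(\<integral>\<^sup>+\<omega>. N (strip j) \<omega> * N (strip k) \<omega> \<partial>P) \<le> 2 * strip_moment"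
proof -
  have sq: "(\<integral>\<^sup>+\<omega>. N (strip k) \<omega> * N (strip k) \<omega> \<partial>P) = strip_moment" for k
  proof -
    have "s + real k \<in> space ell \<longleftrightarrow> s \<in> space ell" for s
      using add_in_ell[OF _ of_nat_in_ell] diff_in_ell[OF _ of_nat_in_ell, of "s + real k" k] by auto
    then have "shift (real k) -` strip k \<inter> space XT = strip 0"
      by (auto simp: shift_def strip_def space_XT)
    then show ?thesis
      unfolding strip_moment_def
      using second_moment_shift[OF strip_sets strip_sets bounded_strip_nat bounded_strip_nat of_nat_in_ell, of k k k]
      by simp
  qed
  have "(\<integral>\<^sup>+\<omega>. N (strip j) \<omega> * N (strip k) \<omega> \<partial>P)
      \<le> (\<integral>\<^sup>+\<omega>. N (strip j) \<omega> * N (strip j) \<omega> + N (strip k) \<omega> * N (strip k) \<omega> \<partial>P)"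
    by (intro nn_integral_mono ennreal_mult_le_sum_squares)
  also have "\<dots> = 2 * strip_moment"
    by (subst nn_integral_add) (simp_all add: sq mult_2)
  finally show ?thesis .
qed

lemma second_moment_window_le:
  assumes t: "1 < t"
  shows "(\<integral>\<^sup>+\<omega>. N (UNIV \<times> ({0<..t} \<inter> space ell)) \<omega> * N (UNIV \<times> ({0<..t} \<inter> space ell)) \<omega> \<partial>P)
    \<le> ennreal (8 * enn2real strip_moment * t\<^sup>2)"
proof -
  \<comment> \<open>Since \<open>t > 1\<close>, this \<open>n\<close> is at most
    \<open>t + 1\<close> and hence at most \<open>2 * t\<close>; the additive rounding error becomes
    a factor.\<close>
  define n where "n = Suc (nat \<lfloor>t\<rfloor>)"
  have n: "t \<le> real n" "real n \<le> 2 * t"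
    using t unfolding n_def by linarith+
  define B where "B = (UNIV :: 'x set) \<times> ({0<..t} \<inter> space ell)"
  have [measurable]: "B \<in> sets XT"
    unfolding B_def by measurable
  have "B \<subseteq> (\<Union>k<n. strip k)"
  proof
    fix p assume "p \<in> B"
    then obtain x s where p: "p = (x, s)" "0 < s" "s \<le> t" "s \<in> space ell"
      by (auto simp: B_def)
    \<comment> \<open>The ceiling minus 1 fits the left-open strips: an integer \<open>s\<close>
      belongs to the strip starting at \<open>s - 1\<close>, not at \<open>s\<close>.\<close>
    define k where "k = nat (\<lceil>s\<rceil> - 1)"
    have "real k < s" "s \<le> real k + 1" "k < n"
      using p(2,3) n(1) unfolding k_def by linarith+
    then have "p \<in> strip k"
      using p by (auto simp: strip_def)
    then show "p \<in> (\<Union>k<n. strip k)"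
      using \<open>k < n\<close> by blast
  qed
  then have "N B \<omega> \<le> (\<Sum>k<n. N (strip k) \<omega>)" for \<omega>
    by (intro order.trans[OF emeasure_mono emeasure_subadditive_finite]) auto
  then have "(\<integral>\<^sup>+\<omega>. N B \<omega> * N B \<omega> \<partial>P) \<le> (\<integral>\<^sup>+\<omega>. (\<Sum>j<n. N (strip j) \<omega>) * (\<Sum>k<n. N (strip k) \<omega>) \<partial>P)"
    by (intro nn_integral_mono mult_mono) auto
  also have "\<dots> = (\<Sum>j<n. \<Sum>k<n. \<integral>\<^sup>+\<omega>. N (strip j) \<omega> * N (strip k) \<omega> \<partial>P)"
    unfolding sum_product by (simp add: nn_integral_sum)
  also have "\<dots> \<le> (\<Sum>j<n. \<Sum>k<n. 2 * strip_moment)"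
    by (intro sum_mono strip_moment_le)
  also have "\<dots> = ennreal (real n * real n * (2 * enn2real strip_moment))"
    using strip_moment_finite
    by (cases strip_moment) (simp_all add: ennreal_mult ennreal_of_nat_eq_real_of_nat mult.assoc)
  also have "\<dots> \<le> ennreal (8 * enn2real strip_moment * t\<^sup>2)"
  proof (rule ennreal_leI)
    have "real n * real n \<le> (2 * t) * (2 * t)"
      using n t by (intro mult_mono) auto
    then have "real n * real n * (2 * enn2real strip_moment) \<le> (2 * t) * (2 * t) * (2 * enn2real strip_moment)"
      by (intro mult_right_mono) auto
    then show "real n * real n * (2 * enn2real strip_moment) \<le> 8 * enn2real strip_moment * t\<^sup>2"
      by (simp add: power2_eq_square algebra_simps)
  qed
  finally show ?thesis
    by (simp add: B_def)
qed

lemma variance_count_le: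
  assumes B: "B \<in> sets XT" "bounded B"
  shows "ennreal (variance (\<lambda>\<omega>. measure (process_measure ell K Z \<omega>) B)) \<le> (\<integral>\<^sup>+\<omega>. N B \<omega> * N B \<omega> \<partial>P)"
proof -
  let ?X = "\<lambda>\<omega>. measure (process_measure ell K Z \<omega>) B"
  have X_meas [measurable]: "?X \<in> borel_measurable P"
    unfolding measure_def using B(1) by measurable
  have X2: "(\<integral>\<^sup>+\<omega>. ennreal ((?X \<omega>)\<^sup>2) \<partial>P) = (\<integral>\<^sup>+\<omega>. N B \<omega> * N B \<omega> \<partial>P)"
    using N_finite[OF _ B]
    by (intro nn_integral_cong)
      (simp add: emeasure_eq_ennreal_measure less_top power2_eq_square ennreal_mult)
  have int2: "integrable P (\<lambda>\<omega>. (?X \<omega>)\<^sup>2)"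
    using second_moment_finite[OF B(1) B(1) B(2) B(2)] X2
    by (intro integrableI_nonneg) auto
  then have int1: "integrable P ?X"
    by (rule square_integrable_imp_integrable[OF X_meas])
  have "variance ?X \<le> expectation (\<lambda>\<omega>. (?X \<omega>)\<^sup>2)"
    using variance_eq[OF int1 int2] by simp
  then have "ennreal (variance ?X) \<le> ennreal (expectation (\<lambda>\<omega>. (?X \<omega>)\<^sup>2))"
    by (rule ennreal_leI)
  also have "\<dots> = (\<integral>\<^sup>+\<omega>. ennreal ((?X \<omega>)\<^sup>2) \<partial>P)"
    using int2 by (intro nn_integral_eq_integral[symmetric]) auto
  finally show ?thesis
    unfolding X2 .
qed

text \<open>The number of cells does not enter: counts of disjoint cells are nonnegative and add up
  to the count of the whole window, so their squares add up to at most its square.\<close>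

lemma sum_variance_le:
  assumes A: "measurable_partition n A" and t: "1 < t"
  shows "(\<Sum>i=1..n. variance (\<lambda>\<omega>. measure (process_measure ell K Z \<omega>) (A i \<times> ({0<..t} \<inter> space ell))))
    \<le> 8 * enn2real strip_moment * t\<^sup>2"
proof -
  let ?I = "{0<..t} \<inter> space ell"
  let ?Y = "\<lambda>i \<omega>. measure (process_measure ell K Z \<omega>) (A i \<times> ?I)"
  have A_sets [measurable]: "A i \<times> ?I \<in> sets XT" if "i \<in> {1..n}" for i
    using A that by (auto simp: measurable_partition_def)
  have bdd: "bounded (A i \<times> ?I)" for i
    by (rule bounded_subset[OF bounded_strip[of ?I]]) (auto simp: bounded_Int)
  have sum_N: "(\<Sum>i=1..n. N (A i \<times> ?I) \<omega>) = N (UNIV \<times> ?I) \<omega>" for \<omega>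
  proof -
    have "(\<Union>i\<in>{1..n}. A i \<times> ?I) = UNIV \<times> ?I"
      using A by (auto simp: measurable_partition_def)
    moreover have "disjoint_family_on (\<lambda>i. A i \<times> ?I) {1..n}"
      using A by (auto simp: measurable_partition_def disjoint_family_on_def)
    moreover have "(\<lambda>i. A i \<times> ?I) ` {1..n} \<subseteq> sets (process_measure ell K Z \<omega>)"
      using A_sets unfolding sets_process_measure by (intro image_subsetI)
    ultimately show ?thesis
      using sum_emeasure[of "\<lambda>i. A i \<times> ?I" "{1..n}" "process_measure ell K Z \<omega>"] by (simp only: finite_atLeastAtMost)
  qed
  have "ennreal (\<Sum>i=1..n. variance (?Y i)) = (\<Sum>i=1..n. ennreal (variance (?Y i)))"
    by (rule sum_ennreal[symmetric]) (rule variance_positive)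
  also have "\<dots> \<le> (\<Sum>i=1..n. \<integral>\<^sup>+\<omega>. N (A i \<times> ?I) \<omega> * N (A i \<times> ?I) \<omega> \<partial>P)"
    by (intro sum_mono variance_count_le A_sets bdd)
  also have "\<dots> = (\<integral>\<^sup>+\<omega>. (\<Sum>i=1..n. N (A i \<times> ?I) \<omega> * N (A i \<times> ?I) \<omega>) \<partial>P)"
    using A_sets by (intro nn_integral_sum[symmetric]) measurable
  also have "\<dots> \<le> (\<integral>\<^sup>+\<omega>. N (UNIV \<times> ?I) \<omega> * N (UNIV \<times> ?I) \<omega> \<partial>P)"
    unfolding sum_N[symmetric] by (intro nn_integral_mono sum_squares_le_square_sum) simp
  also have "\<dots> \<le> ennreal (8 * enn2real strip_moment * t\<^sup>2)"
    by (rule second_moment_window_le[OF t])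
  finally show ?thesis
    by (simp add: ennreal_le_iff)
qed

lemma reduced_moment_le:
  assumes t: "1 < t"
  shows "emeasure M2 (UNIV \<times> UNIV \<times> ({0..t} \<inter> space ell)) \<le> ennreal (4 * enn2real strip_moment * t)"
proof -
  define n where "n = Suc (nat \<lfloor>t\<rfloor>)"
  have n: "t < real n" "real n \<le> 2 * t"
    using t unfolding n_def by linarith+
  define B where "B k = (UNIV :: 'x set) \<times> (UNIV :: 'x set) \<times> ({real k..real k + 1} \<inter> space ell)" for k :: nat
  have B [measurable]: "B k \<in> sets S3" for k
    unfolding B_def by measurable
  have B_le: "emeasure M2 (B k) \<le> 2 * strip_moment" for k
  proof -
    \<comment> \<open>The second time is \<open>r + lag\<close> with \<open>r\<close> in (0,1] and
      the lag in [k,k+1], hence in (k,k+2]; the left end is open because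
      \<open>r > 0\<close>.\<close>
    have "lag_map -` (({0<..1} \<inter> space ell) \<times> B k) \<inter> space (XT \<Otimes>\<^sub>M XT) \<subseteq> strip 0 \<times> strip k"
      unfolding space_pair_measure[of XT XT] by (auto simp: lag_map_def B_def strip_def space_XT)
    then have "emeasure M2 (B k) \<le> emeasure pair_moment (strip 0 \<times> strip k)"
      unfolding reduced_factorial_moment_measure(3)[OF B] by (rule emeasure_mono) simp
    also have "\<dots> \<le> (\<integral>\<^sup>+\<omega>. N (strip 0) \<omega> * N (strip k) \<omega> \<partial>P)"
      by (intro pair_moment_Times_le strip_sets bounded_strip_nat)
    also have "\<dots> \<le> 2 * strip_moment"
      by (rule strip_moment_le)
    finally show ?thesis .
  qed
  have "UNIV \<times> UNIV \<times> ({0..t} \<inter> space ell) \<subseteq> (\<Union>k<n. B k)"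
  proof
    fix p :: "'x \<times> 'x \<times> real"
    assume "p \<in> UNIV \<times> UNIV \<times> ({0..t} \<inter> space ell)"
    then obtain x y s where p: "p = (x, y, s)" "0 \<le> s" "s \<le> t" "s \<in> space ell"
      by auto
    \<comment> \<open>Lags start at 0 inclusive, so the floor is used here with closed unit
      intervals. Their overlap is harmless for subadditivity, and \<open>t < real n\<close> is
      strict so that an integral \<open>s = t\<close> still gets an index below
      \<open>n\<close>.\<close>
    have "real (nat \<lfloor>s\<rfloor>) \<le> s" "s \<le> real (nat \<lfloor>s\<rfloor>) + 1" "nat \<lfloor>s\<rfloor> < n"
      using p(2,3) n(1) by linarith+
    then have "p \<in> B (nat \<lfloor>s\<rfloor>)" "nat \<lfloor>s\<rfloor> < n"
      using p by (auto simp: B_def)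
    then show "p \<in> (\<Union>k<n. B k)"
      by blast
  qed
  then have "emeasure M2 (UNIV \<times> UNIV \<times> ({0..t} \<inter> space ell)) \<le> (\<Sum>k<n. emeasure M2 (B k))"
    by (intro order.trans[OF emeasure_mono emeasure_subadditive_finite])
      (auto simp: reduced_factorial_moment_measure(1))
  also have "\<dots> \<le> (\<Sum>k<n. 2 * strip_moment)"
    by (intro sum_mono B_le)
  also have "\<dots> = ennreal (real n * (2 * enn2real strip_moment))"
    using strip_moment_finite
    by (cases strip_moment) (simp_all add: ennreal_mult ennreal_of_nat_eq_real_of_nat)
  also have "\<dots> \<le> ennreal (4 * enn2real strip_moment * t)"
    using mult_right_mono[OF n(2), of "2 * enn2real strip_moment"]
    by (intro ennreal_leI) (simp add: algebra_simps)
  finally show ?thesis .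
qed

subsection \<open>Positive parts of the reduced covariance\<close>

definition product_moment :: "('x \<times> 'x \<times> real) measure" where
  "product_moment = \<mu> \<Otimes>\<^sub>M \<mu> \<Otimes>\<^sub>M ell"

lemma sets_product_moment: "sets product_moment = sets S3"
  unfolding product_moment_def by (intro sets_pair_measure_cong mark_intensity refl)

lemma product_moment_slab_finite: "emeasure product_moment (slab n) < \<infinity>"
proof -
  interpret \<mu>: finite_measure \<mu>
    by (rule mark_intensity)
  interpret \<mu>_ell: pair_sigma_finite \<mu> ell ..
  have U: "(UNIV :: 'x set) \<in> sets \<mu>"
    by (simp add: mark_intensity)
  have "emeasure product_moment (slab n)
      = emeasure \<mu> UNIV * (emeasure \<mu> UNIV * emeasure ell ({- real n..real n} \<inter> space ell))"
    unfolding product_moment_def slab_def using U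
    by (simp add: \<mu>_ell.emeasure_pair_measure_Times ell.emeasure_pair_measure_Times)
  then show ?thesis
    using emeasure_ell_bounded[of "{- real n..real n} \<inter> space ell"] \<mu>.emeasure_finite[of UNIV]
    by (simp add: ennreal_mult_less_top bounded_Int ennreal_mult_eq_top_iff less_top[symmetric] del: \<mu>.emeasure_finite)
qed

lemma reduced_covariance_eq: "reduced_covariance P ell K Z C = measure M2 C - measure product_moment C"
  by (simp add: reduced_covariance_def M2_def product_moment_def \<mu>_def)

definition time_bounded :: "('x \<times> 'x \<times> real) set set" where
  "time_bounded = {C \<in> sets S3. bounded ((\<lambda>(x, y, s). s) ` C)}"

lemma time_bounded:
  shows time_bounded_sets: "time_bounded \<subseteq> sets S3"
    and time_bounded_hereditary: "\<forall>C\<in>time_bounded. \<forall>B\<in>sets S3. B \<subseteq> C \<longrightarrow> B \<in> time_bounded"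
    and slab_time_bounded: "range slab \<subseteq> time_bounded"
proof -
  have "bounded ((\<lambda>(x, y, s). s) ` slab n)" for n
    by (rule bounded_subset[of "{- real n..real n}"]) (auto simp: slab_def)
  then show "range slab \<subseteq> time_bounded"
    by (auto simp: time_bounded_def)
qed (auto simp: time_bounded_def intro: bounded_subset[OF _ image_mono])

lemma time_bounded_finite:
  assumes C: "C \<in> time_bounded"
  shows "emeasure M2 C < \<infinity>" "emeasure product_moment C < \<infinity>"
proof -
  obtain n where n: "C \<subseteq> slab n"
    using C by (auto simp: time_bounded_def elim: subset_slab)
  have "emeasure M2 C \<le> emeasure M2 (slab n)"
    using n by (intro emeasure_mono) (auto simp: reduced_factorial_moment_measure(1))
  also have "\<dots> < \<infinity>"
    by (intro reduced_factorial_moment_measure(2) bounded_slab) simp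
  finally show "emeasure M2 C < \<infinity>" .
  have "emeasure product_moment C \<le> emeasure product_moment (slab n)"
    using n by (intro emeasure_mono) (auto simp: sets_product_moment)
  then show "emeasure product_moment C < \<infinity>"
    using product_moment_slab_finite by (rule le_less_trans)
qed

lemma reduced_covariance_pos:
  shows sets_reduced_covariance_pos: "sets (reduced_covariance_pos P ell K Z) = sets S3"
    and reduced_covariance_pos_eq: "\<exists>D\<in>sets S3. \<forall>C\<in>time_bounded.
      emeasure (reduced_covariance_pos P ell K Z) C = ennreal (reduced_covariance P ell K Z (C \<inter> D))"
    and reduced_covariance_pos_ge: "C \<in> time_bounded \<Longrightarrow> B \<in> sets S3 \<Longrightarrow> B \<subseteq> C \<Longrightarrow>
      ennreal (reduced_covariance P ell K Z B) \<le> emeasure (reduced_covariance_pos P ell K Z) C"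
proof -
  have eq: "reduced_covariance_pos P ell K Z
      = jordan_positive_part S3 time_bounded (reduced_covariance P ell K Z)"
    by (simp add: reduced_covariance_pos_def time_bounded_def)
  note hyps = reduced_factorial_moment_measure(1) sets_product_moment time_bounded_sets
    time_bounded_hereditary time_bounded_finite reduced_covariance_eq slab_time_bounded incseq_slab UN_slab
  show "sets (reduced_covariance_pos P ell K Z) = sets S3"
    unfolding eq by (rule sets_jordan_positive_part[OF hyps])
  show "\<exists>D\<in>sets S3. \<forall>C\<in>time_bounded.
      emeasure (reduced_covariance_pos P ell K Z) C = ennreal (reduced_covariance P ell K Z (C \<inter> D))"
    unfolding eq by (rule jordan_positive_part_eq[OF hyps])
  show "ennreal (reduced_covariance P ell K Z B) \<le> emeasure (reduced_covariance_pos P ell K Z) C"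
    if "C \<in> time_bounded" "B \<in> sets S3" "B \<subseteq> C"
    unfolding eq by (rule jordan_positive_part_ge[OF hyps]) (use that in simp_all)
qed

text \<open>On the Hahn set the covariance is a difference of two finite measures; dropping the
  subtracted product term leaves part of \<open>M2\<close>. The growth of \<open>M2\<close> is
  therefore all that has to be estimated.\<close>

lemma reduced_covariance_pos_le:
  assumes C: "C \<in> time_bounded"
  shows "emeasure (reduced_covariance_pos P ell K Z) C \<le> emeasure M2 C"
proof -
  obtain D where D: "D \<in> sets S3"
      "emeasure (reduced_covariance_pos P ell K Z) C = ennreal (reduced_covariance P ell K Z (C \<inter> D))"
    using reduced_covariance_pos_eq C by blast
  have "C \<inter> D \<in> time_bounded"
    using time_bounded_hereditary C D(1) time_bounded_sets by (meson inf_le1 sets.Int subsetD)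
  then have fin: "emeasure M2 (C \<inter> D) < \<infinity>"
    by (rule time_bounded_finite)
  have "emeasure (reduced_covariance_pos P ell K Z) C \<le> ennreal (measure M2 (C \<inter> D))"
    unfolding D(2) reduced_covariance_eq by (intro ennreal_leI) simp
  also have "\<dots> = emeasure M2 (C \<inter> D)"
    using fin by (simp add: emeasure_eq_ennreal_measure less_top)
  also have "\<dots> \<le> emeasure M2 C"
    using C by (intro emeasure_mono) (auto simp: reduced_factorial_moment_measure(1) time_bounded_def)
  finally show ?thesis .
qed

text \<open>To apply the Jordan lemmas on the time axis, the covariance of a fixed mark set must be
  a difference of measures on \<open>ell\<close>. Restricting to the cylinder over
  \<open>A \<times> A\<close> and projecting to time produces each of the two.\<close>

lemma section_measure:
  assumes M: "sets M = sets S3" and A: "A \<in> sets borel"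
  obtains M' where "sets M' = sets ell" "\<And>S. S \<in> sets ell \<Longrightarrow> emeasure M' S = emeasure M (A \<times> A \<times> S)"
proof
  let ?\<Omega> = "A \<times> A \<times> space ell"
  have \<Omega>: "?\<Omega> \<in> sets M"
    using A by (simp add: M)
  have proj: "(\<lambda>(x, y, s). s) \<in> restrict_space M ?\<Omega> \<rightarrow>\<^sub>M ell"
    by (intro measurable_restrict_space1) (simp add: measurable_cong_sets[OF M refl])
  show "sets (distr (restrict_space M ?\<Omega>) ell (\<lambda>(x, y, s). s)) = sets ell"
    by simp
  fix S assume S: "S \<in> sets ell"
  have "(\<lambda>(x, y, s). s) -` S \<inter> space (restrict_space M ?\<Omega>) = A \<times> A \<times> S"
    using sets.sets_into_space[OF S] sets_eq_imp_space_eq[OF M] by (auto simp: space_restrict_space space_S3)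
  then have "emeasure (distr (restrict_space M ?\<Omega>) ell (\<lambda>(x, y, s). s)) S = emeasure (restrict_space M ?\<Omega>) (A \<times> A \<times> S)"
    using S proj by (simp add: emeasure_distr)
  also have "\<dots> = emeasure M (A \<times> A \<times> S)"
    using \<Omega> sets.sets_into_space[OF S] sets.sets_into_space[OF \<Omega>]
    by (intro emeasure_restrict_space) (auto simp: Int_absorb2)
  finally show "emeasure (distr (restrict_space M ?\<Omega>) ell (\<lambda>(x, y, s). s)) S = emeasure M (A \<times> A \<times> S)" .
qed

lemma box_time_bounded: "A \<in> sets borel \<Longrightarrow> B \<in> sets borel \<Longrightarrow> S \<in> sets ell \<Longrightarrow> bounded S \<Longrightarrow> A \<times> B \<times> S \<in> time_bounded"
  by (auto simp: time_bounded_def intro: bounded_subset[of S])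

lemma reduced_covariance_on_pos_le:
  assumes A: "A \<in> sets borel" and S: "S \<in> sets ell" "bounded S"
  shows "emeasure (reduced_covariance_on_pos P ell K Z A) S
    \<le> emeasure (reduced_covariance_pos P ell K Z) (A \<times> A \<times> S)"
proof -
  obtain M where M: "sets M = sets ell" "\<And>S. S \<in> sets ell \<Longrightarrow> emeasure M S = emeasure M2 (A \<times> A \<times> S)"
    by (rule section_measure[OF reduced_factorial_moment_measure(1) A]) auto
  obtain M' where M': "sets M' = sets ell" "\<And>S. S \<in> sets ell \<Longrightarrow> emeasure M' S = emeasure product_moment (A \<times> A \<times> S)"
    by (rule section_measure[OF sets_product_moment A]) auto
  let ?\<C> = "{S \<in> sets ell. bounded S}"
  let ?F = "\<lambda>n. {- real n..real n} \<inter> space ell"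
  \<comment> \<open>This Hahn set belongs to the covariance on the time axis. The cylinder over it
    need not be a Hahn set of the full covariance, so only an inequality results.\<close>
  obtain D where D: "D \<in> sets ell" "emeasure (reduced_covariance_on_pos P ell K Z A) S
      = ennreal (reduced_covariance P ell K Z (A \<times> A \<times> (S \<inter> D)))"
  proof -
    have "\<exists>D\<in>sets ell. \<forall>S\<in>?\<C>. emeasure (jordan_positive_part ell ?\<C> (\<lambda>S. reduced_covariance P ell K Z (A \<times> A \<times> S))) S
        = ennreal (reduced_covariance P ell K Z (A \<times> A \<times> (S \<inter> D)))"
    proof (rule jordan_positive_part_eq[OF M(1) M'(1)])
      show "emeasure M S < \<infinity>" "emeasure M' S < \<infinity>" if "S \<in> ?\<C>" for S
        using that box_time_bounded[OF A A, of S] time_bounded_finite[of "A \<times> A \<times> S"] by (simp_all add: M M')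
      show "reduced_covariance P ell K Z (A \<times> A \<times> S) = measure M S - measure M' S" if "S \<in> ?\<C>" for S
        using that by (simp add: reduced_covariance_eq measure_def M M')
      show "range ?F \<subseteq> ?\<C>"
        by (auto simp: bounded_Int)
      show "incseq ?F"
        by (auto simp: incseq_def)
      show "(\<Union>n. ?F n) = space ell"
        by (rule UN_centered_intervals)
    qed (auto intro: bounded_subset)
    then show thesis
      using S that by (auto simp: reduced_covariance_on_pos_def)
  qed
  have "A \<times> A \<times> S \<in> time_bounded"
    using A A S by (rule box_time_bounded)
  then show ?thesis
    unfolding D(2)
    using A S D(1) by (intro reduced_covariance_pos_ge) auto
qed

text \<open>The blocks \<open>A i \<times> A i\<close> leave out the pairs of marks in different
  cells, so after additivity over the blocks monotonicity of the positive part is still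
  needed.\<close>

lemma sum_reduced_covariance_on_pos_le:
  assumes A: "measurable_partition n A" and S: "S \<in> sets ell" "bounded S"
  shows "(\<Sum>i=1..n. emeasure (reduced_covariance_on_pos P ell K Z (A i)) S)
    \<le> emeasure (reduced_covariance_pos P ell K Z) (UNIV \<times> UNIV \<times> S)"
proof -
  have A_sets: "A i \<in> sets borel" if "i \<in> {1..n}" for i
    using A that by (auto simp: measurable_partition_def)
  have "(\<Sum>i=1..n. emeasure (reduced_covariance_on_pos P ell K Z (A i)) S)
      \<le> (\<Sum>i=1..n. emeasure (reduced_covariance_pos P ell K Z) (A i \<times> A i \<times> S))"
    using A_sets S by (intro sum_mono reduced_covariance_on_pos_le) auto
  also have "\<dots> = emeasure (reduced_covariance_pos P ell K Z) (\<Union>i\<in>{1..n}. A i \<times> A i \<times> S)"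
  proof (rule sum_emeasure)
    show "disjoint_family_on (\<lambda>i. A i \<times> A i \<times> S) {1..n}"
      using A by (auto simp: measurable_partition_def disjoint_family_on_def)
    show "(\<lambda>i. A i \<times> A i \<times> S) ` {1..n} \<subseteq> sets (reduced_covariance_pos P ell K Z)"
      unfolding sets_reduced_covariance_pos
      by (intro image_subsetI pair_measureI A_sets S)
  qed simp
  also have "\<dots> \<le> emeasure (reduced_covariance_pos P ell K Z) (UNIV \<times> UNIV \<times> S)"
    using S by (intro emeasure_mono) (auto simp: sets_reduced_covariance_pos)
  finally show ?thesis .
qed

end

theorem proposition4p6:
  fixes P :: "'w measure"
    and ell :: "real measure"
    and K :: "'w \<Rightarrow> nat set"
    and Z :: "'w \<Rightarrow> nat \<Rightarrow> 'x::polish_space \<times> real"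
  assumes "ell = lborel \<or> ell = count_space \<int>"
    and "bounded (UNIV :: 'x set)"
    and "point_process P ell K Z"
    and "weakly_time_stationary_L2 P ell K Z"
  shows "\<exists>\<kappa>::real. \<kappa> > 0 \<and>
    (\<forall>N A t. measurable_partition N A \<and> t \<in> space ell \<and> t > 1 \<longrightarrow>
      (\<Sum>i=1..N. prob_space.variance P
         (\<lambda>\<omega>. measure (process_measure ell K Z \<omega>) (A i \<times> ({0<..t} \<inter> space ell))))
        \<le> \<kappa> * t\<^sup>2 \<and>
      (\<Sum>i=1..N. emeasure (reduced_covariance_on_pos P ell K Z (A i)) ({0..t} \<inter> space ell))
        \<le> emeasure (reduced_covariance_pos P ell K Z) (UNIV \<times> UNIV \<times> ({0..t} \<inter> space ell)) \<and>
      emeasure (reduced_covariance_pos P ell K Z) (UNIV \<times> UNIV \<times> ({0..t} \<inter> space ell))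
        \<le> ennreal (\<kappa> * t))"
proof -
  interpret stationary_process ell P K Z
    using assms by unfold_locales
  define c where "c = enn2real strip_moment"
  have c: "0 \<le> c"
    by (simp add: c_def)
  show ?thesis
  \<comment> \<open>The variance bound needs \<open>8 * c\<close>, which exceeds the
    \<open>4 * c\<close> of the covariance bound; the summand 1 keeps the constant positive when
    \<open>c = 0\<close>.\<close>
  proof (intro exI[of _ "8 * c + 1"] conjI allI impI; (elim conjE)?)
    show "0 < 8 * c + 1"
      using c by simp
  next
    fix n :: nat and A :: "nat \<Rightarrow> 'x set" and t :: real
    assume A: "measurable_partition n A" and t: "1 < t"
    have "(\<Sum>i=1..n. variance (\<lambda>\<omega>. measure (process_measure ell K Z \<omega>) (A i \<times> ({0<..t} \<inter> space ell))))
        \<le> 8 * c * t\<^sup>2"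
      unfolding c_def by (rule sum_variance_le[OF A t])
    also have "\<dots> \<le> (8 * c + 1) * t\<^sup>2"
      by (intro mult_right_mono) auto
    finally show "(\<Sum>i=1..n. variance (\<lambda>\<omega>. measure (process_measure ell K Z \<omega>) (A i \<times> ({0<..t} \<inter> space ell))))
        \<le> (8 * c + 1) * t\<^sup>2" .
    have S: "{0..t} \<inter> space ell \<in> sets ell" "bounded ({0..t} \<inter> space ell)"
      by (auto simp: bounded_Int)
    show "(\<Sum>i=1..n. emeasure (reduced_covariance_on_pos P ell K Z (A i)) ({0..t} \<inter> space ell))
        \<le> emeasure (reduced_covariance_pos P ell K Z) (UNIV \<times> UNIV \<times> ({0..t} \<inter> space ell))"
      by (rule sum_reduced_covariance_on_pos_le[OF A S])
    have "emeasure (reduced_covariance_pos P ell K Z) (UNIV \<times> UNIV \<times> ({0..t} \<inter> space ell))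
        \<le> emeasure M2 (UNIV \<times> UNIV \<times> ({0..t} \<inter> space ell))"
      using S by (intro reduced_covariance_pos_le box_time_bounded) auto
    also have "\<dots> \<le> ennreal (4 * c * t)"
      unfolding c_def by (rule reduced_moment_le[OF t])
    also have "\<dots> \<le> ennreal ((8 * c + 1) * t)"
      using c t by (intro ennreal_leI mult_right_mono) auto
    finally show "emeasure (reduced_covariance_pos P ell K Z) (UNIV \<times> UNIV \<times> ({0..t} \<inter> space ell))
        \<le> ennreal ((8 * c + 1) * t)" .
  qed
qed

end
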